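(* Let $P\subset2\Delta_n$ be a smooth lattice polytope of dimension $n$. Then $P$ is $AGL_n(\mathbb{Z})$-equivalent to one of $$\Delta_n,\quad 2\Delta_n,\quad (2\Delta_n)_k\ (0\le k\le n-2),\quad \Delta_\ell\times\Delta_{n-\ell}\ (1\le\ell\le n-1).$$
   Context: A lattice polytope $P\subset\mathbb{R}^n$ is smooth if it is simple (each vertex lies on exactly $\dim P$ edges) and the first lattice vectors along the edges incident at any vertex form part of a $\mathbb{Z}$-basis of $\mathbb{Z}^n$. $AGL_n(\mathbb{Z})$ is the group of affine linear isomorphisms of $\mathbb{Z}^n$. $\Delta_n=\{p\in\mathbb{R}^n_{\ge0}\mid p_1+\cdots+p_n\le1\}$, $2\Delta_n=\{p\in\mathbb{R}^n_{\ge0}\mid p_1+\cdots+p_n\le2\}$, and $(2\Delta_n)_k$ is the convex hull of the lattice points of $2\Delta_n\setminus F$, where $F$ is a $k$-dimensional face of $2\Delta_n$. *)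

theory Defs
  imports "HOL-Analysis.Analysis"
begin

definition int_lattice :: "(real ^ 'n) set" where
  "int_lattice = {x. \<forall>i. x $ i \<in> \<int>}"

definition lattice_basis :: "(real ^ 'n) set \<Rightarrow> bool" where
  "lattice_basis B \<longleftrightarrow>
     finite B \<and> B \<subseteq> int_lattice \<and>
     (\<forall>c :: real ^ 'n \<Rightarrow> int. (\<Sum>b\<in>B. of_int (c b) *\<^sub>R b) = 0 \<longrightarrow> (\<forall>b\<in>B. c b = 0)) \<and>
     (\<forall>x\<in>int_lattice. \<exists>c :: real ^ 'n \<Rightarrow> int. x = (\<Sum>b\<in>B. of_int (c b) *\<^sub>R b))"

definition lattice_polytope :: "(real ^ 'n) set \<Rightarrow> bool" where
  "lattice_polytope P \<longleftrightarrow> (\<exists>V. finite V \<and> V \<subseteq> int_lattice \<and> P = convex hull V)"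

definition simple_polytope :: "(real ^ 'n) set \<Rightarrow> bool" where
  "simple_polytope P \<longleftrightarrow>
     polytope P \<and>
     (\<forall>v. v extreme_point_of P \<longrightarrow> int (card {E. E edge_of P \<and> v \<in> E}) = aff_dim P)"

text \<open>The vector \<open>u\<close> leads from the endpoint \<open>v\<close> of the edge \<open>E\<close> to the first lattice
  point after \<open>v\<close> on \<open>E\<close>. When both endpoints of \<open>E\<close> are lattice points, such a \<open>u\<close> exists
  and is the primitive lattice vector in the direction of \<open>E\<close>.\<close>

definition first_lattice_vector :: "real ^ 'n \<Rightarrow> (real ^ 'n) set \<Rightarrow> real ^ 'n \<Rightarrow> bool" where
  "first_lattice_vector v E u \<longleftrightarrow>
     u \<in> int_lattice \<and> u \<noteq> 0 \<and> v + u \<in> E \<and>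
     (\<forall>s::real. 0 < s \<and> s < 1 \<longrightarrow> s *\<^sub>R u \<notin> int_lattice)"

definition edge_vectors :: "(real ^ 'n) set \<Rightarrow> real ^ 'n \<Rightarrow> (real ^ 'n) set" where
  "edge_vectors P v = {u. \<exists>E. E edge_of P \<and> v \<in> E \<and> first_lattice_vector v E u}"

definition smooth_polytope :: "(real ^ 'n) set \<Rightarrow> bool" where
  "smooth_polytope P \<longleftrightarrow>
     lattice_polytope P \<and> simple_polytope P \<and>
     (\<forall>v. v extreme_point_of P \<longrightarrow> (\<exists>B. lattice_basis B \<and> edge_vectors P v \<subseteq> B))"

text \<open>Affine isomorphisms of the lattice, as maps of the ambient real vector space.\<close>

definition AGL_int :: "(real ^ 'n \<Rightarrow> real ^ 'n) set" where
  "AGL_int = {f. \<exists>L b. linear L \<and> bij_betw L int_lattice int_lattice \<and> b \<in> int_lattice \<and>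
                       f = (\<lambda>x. L x + b)}"

definition AGL_equivalent :: "(real ^ 'n) set \<Rightarrow> (real ^ 'n) set \<Rightarrow> bool" where
  "AGL_equivalent P Q \<longleftrightarrow> (\<exists>f\<in>AGL_int. f ` P = Q)"

definition dilated_simplex :: "real \<Rightarrow> (real ^ 'n) set" where
  "dilated_simplex c = {p. (\<forall>i. 0 \<le> p $ i) \<and> (\<Sum>i\<in>UNIV. p $ i) \<le> c}"

text \<open>For a \<open>k\<close>-dimensional face \<open>F\<close> of \<open>2\<Delta>\<^sub>n\<close> this is \<open>(2\<Delta>\<^sub>n)\<^sub>k\<close>; different choices
  of \<open>F\<close> of the same dimension give equivalent polytopes.\<close>

definition truncated_double_simplex :: "(real ^ 'n) set \<Rightarrow> (real ^ 'n) set" where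
  "truncated_double_simplex F = convex hull (int_lattice \<inter> (dilated_simplex 2 - F))"

text \<open>The product \<open>\<Delta>\<^sub>l \<times> \<Delta>\<^sub>n\<^sub>-\<^sub>l\<close> with \<open>l = card I\<close>: the coordinates in \<open>I\<close> are those of
  the first factor, the remaining ones those of the second.\<close>

definition simplex_product :: "'n set \<Rightarrow> (real ^ 'n) set" where
  "simplex_product I =
     {p. (\<forall>i. 0 \<le> p $ i) \<and> (\<Sum>i\<in>I. p $ i) \<le> 1 \<and> (\<Sum>i\<in>- I. p $ i) \<le> 1}"

end

theory Submission
  imports Defs
begin

text \<open>Call a linear functional \<open>a\<close> a peak at a lattice point \<open>v\<close> of \<open>P\<close> if \<open>a\<close> takes its maximum over
  the lattice points of \<open>P\<close> only at \<open>v\<close>.  Such a \<open>v\<close> is a vertex, and by smoothness \<open>P\<close> lies in the cone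
  at \<open>v\<close> generated by a lattice basis \<open>B\<close> with \<open>v + B \<subseteq> P\<close>.  If \<open>a\<close> is integral and varies by at most 2
  on \<open>P\<close>, the coefficients of every lattice point with respect to \<open>B\<close> sum to at most 2.  A polytope inside
  \<open>2\<Delta>\<^sub>n\<close> always has such a peak, so moving \<open>v\<close> to 0 and \<open>B\<close> to the unit vectors we may assume
  \<open>\<Delta>\<^sub>n \<subseteq> P \<subseteq> 2\<Delta>\<^sub>n\<close>.

  Now \<open>P\<close> is determined by the graph with loops of all \<open>{i, j}\<close> with \<open>e\<^sub>i + e\<^sub>j \<in> P\<close>.  At a peak all
  lattice points one level below it belong to \<open>v + B\<close>, so they satisfy no relation \<open>p + q = r + s\<close>.
  At \<open>e\<^sub>j\<close> this makes non-adjacency transitive through every loopless \<open>j\<close>, and at \<open>e\<^sub>j + e\<^sub>k\<close>, with \<open>j\<close> and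
  \<open>k\<close> loopless, it forbids a common neighbour of \<open>j\<close> and \<open>k\<close>.  Only four kinds of graphs remain: no edges
  (\<open>\<Delta>\<^sub>n\<close>), complete bipartite (the products), all edges and loops (\<open>2\<Delta>\<^sub>n\<close>), and all
  edges and loops that meet the complement of a proper nonempty subset (the truncations).\<close>

section \<open>Faces and vertex figures of polytopes\<close>

text \<open>Take a face of least dimension among those containing \<open>q\<close>. If
  \<open>q\<close> were on its relative frontier, some facet of it would be a smaller face of
  \<open>P\<close> through \<open>q\<close>.\<close>

lemma face_of_polytope_rel_interior_exists:
  fixes P :: "'a::euclidean_space set"
  assumes "polytope P" "q \<in> P"
  obtains F where "F face_of P" "q \<in> rel_interior F"
proof -
  define S where "S = {F. F face_of P \<and> q \<in> F}"
  have "P \<in> S"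
    using assms by (auto simp: S_def polytope_imp_convex face_of_refl)
  then obtain F where F: "F \<in> S" and min: "\<And>G. G \<in> S \<Longrightarrow> nat (aff_dim F + 1) \<le> nat (aff_dim G + 1)"
    using arg_min_natI[of "\<lambda>F. F \<in> S" P "\<lambda>F. nat (aff_dim F + 1)"]
      arg_min_nat_le[of "\<lambda>F. F \<in> S" _ "\<lambda>F. nat (aff_dim F + 1)"] by blast
  have "q \<in> rel_interior F"
  proof (rule ccontr)
    assume "q \<notin> rel_interior F"
    moreover have "polytope F"
      using F assms face_of_polytope_polytope by (auto simp: S_def)
    ultimately have "q \<in> \<Union> {G. G facet_of F}"
      using F rel_frontier_of_polyhedron[OF polytope_imp_polyhedron, of F]
      by (auto simp: S_def rel_frontier_def polytope_imp_closed)
    then obtain G where G: "G facet_of F" "q \<in> G"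
      by blast
    then have "G \<in> S"
      using F face_of_trans[OF facet_of_imp_face_of] by (auto simp: S_def)
    then have "nat (aff_dim F + 1) \<le> nat (aff_dim G + 1)"
      by (rule min)
    \<comment> \<open>Facets are nonempty, so the dimension of \<open>G\<close> is at least 0 and
      the truncation by \<open>nat\<close> loses nothing.\<close>
    moreover have "aff_dim G = aff_dim F - 1" "\<not> aff_dim G < 0"
      using G unfolding aff_dim_negative_iff by (auto simp: facet_of_def)
    ultimately show False
      by linarith
  qed
  with F show ?thesis
    by (auto simp: S_def intro: that)
qed

text \<open>Let \<open>F\<close> be the face with \<open>q\<close> in its relative interior.
  Extremality of \<open>q\<close> lets the affine hull of \<open>F\<close> meet the hyperplane in
  \<open>q\<close> alone, and a hyperplane section lowers the dimension by at most one.\<close>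

lemma extreme_point_hyperplane_section_face:
  fixes P :: "'a::euclidean_space set"
  assumes "polytope P" and q: "q extreme_point_of (P \<inter> {x. a \<bullet> x = b})"
  obtains F where "F face_of P" "q \<in> F" "aff_dim F \<le> 1"
proof -
  have "q \<in> P" and qb: "a \<bullet> q = b"
    using q by (auto simp: extreme_point_of_def)
  then obtain F where F: "F face_of P" "q \<in> rel_interior F"
    using face_of_polytope_rel_interior_exists assms(1) by metis
  then obtain e where e: "e > 0" "ball q e \<inter> affine hull F \<subseteq> F"
    by (auto simp: mem_rel_interior_ball)
  have qF: "q \<in> F"
    using F rel_interior_subset by blast
  have FP: "F \<subseteq> P"
    using F face_of_imp_subset by blast
  have "y = q" if y: "y \<in> affine hull F" "a \<bullet> y = b" for y
  proof (rule ccontr)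
    assume "y \<noteq> q"
    \<comment> \<open>Small enough for \<open>q + t *\<^sub>R (y - q)\<close> and its mirror image
      in \<open>q\<close> to stay in \<open>F\<close>; then \<open>q\<close> is the midpoint of a
      segment in the section.\<close>
    define t where "t = e / (2 * norm (y - q))"
    have "norm (y - q) > 0"
      using \<open>y \<noteq> q\<close> by simp
    then have "t > 0" "t * norm (y - q) < e"
      using e by (auto simp: t_def field_simps simp del: zero_less_norm_iff)
    then have t: "t > 0" "norm (t *\<^sub>R (y - q)) < e"
      by auto
    have aff: "q + s *\<^sub>R (y - q) \<in> affine hull F" for s
      using mem_affine[OF affine_affine_hull hull_inc[OF qF] y(1), of "1 - s" s]
      by (simp add: algebra_simps)
    have "q + t *\<^sub>R (y - q) \<in> F" "q + (- t) *\<^sub>R (y - q) \<in> F"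
      by (rule subsetD[OF e(2)], rule IntI[OF _ aff],
          use t in \<open>simp add: dist_norm del: norm_scaleR\<close>)+
    then have "q + t *\<^sub>R (y - q) \<in> P \<inter> {x. a \<bullet> x = b}" "q + (- t) *\<^sub>R (y - q) \<in> P \<inter> {x. a \<bullet> x = b}"
      using FP qb y(2) by (auto simp: inner_add_right inner_diff_right)
    moreover have "q \<in> open_segment (q + t *\<^sub>R (y - q)) (q + (- t) *\<^sub>R (y - q))"
    proof -
      have "q + t *\<^sub>R (y - q) \<noteq> q + (- t) *\<^sub>R (y - q)"
        using t(1) \<open>y \<noteq> q\<close> by (simp add: scaleR_cancel_right del: scaleR_minus_left)
      moreover have "q = (1/2) *\<^sub>R (q + t *\<^sub>R (y - q)) + (1/2) *\<^sub>R (q + (- t) *\<^sub>R (y - q))"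
        by (simp flip: scaleR_add_right add: scaleR_2[symmetric])
      ultimately show ?thesis
        unfolding in_segment by (intro conjI exI[of _ "1/2"]) auto
    qed
    ultimately show False
      using q by (auto simp: extreme_point_of_def)
  qed
  then have "affine hull F \<inter> {x. a \<bullet> x = b} = {q}"
    using qF qb hull_inc by fastforce
  then have "(if affine hull F \<subseteq> {v. a \<bullet> v = b} then aff_dim F else aff_dim F - 1) = 0"
    using aff_dim_affine_Int_hyperplane[of "affine hull F" a b] unfolding aff_dim_affine_hull by simp
  then have "aff_dim F \<le> 1"
    by (auto split: if_splits)
  with F qF show ?thesis
    using that by blast
qed

text \<open>The proof cuts \<open>P\<close> with a hyperplane separating \<open>w\<close> from the other vertices: the vertices of
  this vertex figure lie on edges through \<open>w\<close>.\<close>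

lemma polytope_subset_edge_cone:
  fixes P :: "'a::euclidean_space set"
  assumes P: "polytope P" and w: "w extreme_point_of P"
    and C: "convex C" "cone C" "0 \<in> C"
    and edges: "\<And>E x. E edge_of P \<Longrightarrow> w \<in> E \<Longrightarrow> x \<in> E \<Longrightarrow> x - w \<in> C"
    and p: "p \<in> P"
  shows "p - w \<in> C"
proof -
  define V where "V = {v. v extreme_point_of P}"
  have hull: "P = convex hull V"
    using P by (simp add: V_def Krein_Milman_Minkowski polytope_imp_compact polytope_imp_convex)
  have "finite V"
    using P by (auto simp: V_def polytope_def dest: extreme_point_of_convex_hull
        intro: finite_subset)
  have "V \<subseteq> P" "w \<in> P"
    using w by (auto simp: V_def extreme_point_of_def)
  \<comment> \<open>Since \<open>w\<close> is extreme, \<open>P - {w}\<close> is convex and so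
    contains the hull of the other vertices.\<close>
  have "w \<notin> convex hull (V - {w})"
    using w \<open>V \<subseteq> P\<close> polytope_imp_convex[OF P] hull_minimal[of "V - {w}" "P - {w}" convex]
    by (auto simp: extreme_point_of_stillconvex)
  moreover have "closed (convex hull (V - {w}))"
    using \<open>finite V\<close> by (simp add: compact_imp_closed finite_imp_compact_convex_hull)
  ultimately obtain a b where ab: "a \<bullet> w < b" "\<forall>x\<in>convex hull (V - {w}). a \<bullet> x > b"
    using separating_hyperplane_closed_point[of "convex hull (V - {w})" w] by auto
  have Cw: "convex ((+) w ` C)"
    using C(1) by (rule convex_translation)
  have mem: "x - w \<in> C \<longleftrightarrow> x \<in> (+) w ` C" for x
    by (force simp: image_iff algebra_simps)
  define Q where "Q = P \<inter> {x. a \<bullet> x = b}"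
  have "q - w \<in> C" if q: "q extreme_point_of Q" for q
  proof -
    obtain F where F: "F face_of P" "q \<in> F" "aff_dim F \<le> 1"
      using extreme_point_hyperplane_section_face[OF P] q unfolding Q_def by metis
    have qb: "a \<bullet> q = b"
      using q by (auto simp: Q_def extreme_point_of_def)
    have "compact F" "convex F"
      using F P face_of_polytope_polytope polytope_imp_compact polytope_imp_convex by blast+
    then have Fhull: "F = convex hull {v. v extreme_point_of F}"
      by (rule Krein_Milman_Minkowski)
    have sub: "{v. v extreme_point_of F} \<subseteq> V"
      using F(1) by (auto simp: V_def extreme_point_of_face)
    \<comment> \<open>Without \<open>w\<close>, the face \<open>F\<close> would be spanned by
      vertices strictly beyond the cutting hyperplane, yet it contains \<open>q\<close>, which lies
      on it.\<close>
    have "w \<in> F"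
    proof (rule ccontr)
      assume "w \<notin> F"
      then have "{v. v extreme_point_of F} \<subseteq> V - {w}"
        using sub by (auto simp: extreme_point_of_def)
      then have "q \<in> convex hull (V - {w})"
        using F(2) Fhull hull_mono by blast
      then show False
        using ab(2) qb by auto
    qed
    have "aff_dim F \<noteq> 0"
      using aff_dim_eq_0[of F] \<open>w \<in> F\<close> F(2) ab(1) qb by auto
    moreover have "\<not> aff_dim F < 0"
      using F(2) unfolding aff_dim_negative_iff by auto
    ultimately have "aff_dim F = 1"
      using F(3) by linarith
    then have "F edge_of P"
      using F by (simp add: edge_of_def)
    then show ?thesis
      using edges \<open>w \<in> F\<close> F(2) by blast
  qed
  moreover have "Q = convex hull {q. q extreme_point_of Q}"
    unfolding Q_def using P
    by (intro Krein_Milman_Minkowski compact_Int_closed convex_Int)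
      (auto simp: polytope_imp_compact polytope_imp_convex closed_hyperplane convex_hyperplane)
  ultimately have Q: "Q \<subseteq> (+) w ` C"
    using Cw mem by (metis (no_types, lifting) hull_minimal mem_Collect_eq subsetI)
  have "v - w \<in> C" if v: "v \<in> V" for v
  proof (cases "v = w")
    case False
    \<comment> \<open>The parameter at which the segment from \<open>w\<close> to \<open>v\<close>
      crosses the hyperplane. The crossing point lies in \<open>Q\<close>, and a cone allows scaling
      back by \<open>1 / t\<close>.\<close>
    define t where "t = (b - a \<bullet> w) / (a \<bullet> v - a \<bullet> w)"
    have "a \<bullet> v > b"
      using ab(2) v False by (simp add: hull_inc)
    then have t: "0 < t" "t < 1" "t * (a \<bullet> v - a \<bullet> w) = b - a \<bullet> w"
      using ab(1) by (auto simp: t_def field_simps)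
    have "(1 - t) *\<^sub>R w + t *\<^sub>R v \<in> P"
      using convexD_alt[OF polytope_imp_convex[OF P] \<open>w \<in> P\<close>, of v t] t v \<open>V \<subseteq> P\<close> by auto
    moreover have "a \<bullet> ((1 - t) *\<^sub>R w + t *\<^sub>R v) = b"
      using t(3) by (simp add: inner_add_right algebra_simps)
    ultimately have "(1 - t) *\<^sub>R w + t *\<^sub>R v \<in> Q"
      by (simp add: Q_def)
    then have "t *\<^sub>R (v - w) \<in> C"
      using Q mem[of "(1 - t) *\<^sub>R w + t *\<^sub>R v"] by (auto simp: algebra_simps)
    then have "(1 / t) *\<^sub>R t *\<^sub>R (v - w) \<in> C"
      using C(2) t(1) mem_cone[of C "t *\<^sub>R (v - w)" "1 / t"] by simp
    then show ?thesis
      using t(1) by simp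
  qed (use C(3) in simp)
  then have "P \<subseteq> (+) w ` C"
    unfolding hull using Cw mem by (metis hull_minimal subsetI)
  with p mem show ?thesis
    by blast
qed

section \<open>The integer lattice and its bases\<close>

lemma int_lattice_add: "x \<in> int_lattice \<Longrightarrow> y \<in> int_lattice \<Longrightarrow> x + y \<in> int_lattice"
  and int_lattice_diff: "x \<in> int_lattice \<Longrightarrow> y \<in> int_lattice \<Longrightarrow> x - y \<in> int_lattice"
  and int_lattice_zero: "0 \<in> int_lattice"
  and int_lattice_axis: "axis i 1 \<in> int_lattice"
  by (auto simp: int_lattice_def axis_def)

lemma int_lattice_sum: "(\<And>i. i \<in> A \<Longrightarrow> f i \<in> int_lattice) \<Longrightarrow> sum f A \<in> int_lattice"
  by (auto simp: int_lattice_def)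

lemma int_lattice_of_int_scaleR: "x \<in> int_lattice \<Longrightarrow> of_int k *\<^sub>R x \<in> int_lattice"
  by (auto simp: int_lattice_def)

lemma int_lattice_inner: "x \<in> int_lattice \<Longrightarrow> y \<in> int_lattice \<Longrightarrow> x \<bullet> y \<in> \<int>"
  by (auto simp: int_lattice_def inner_vec_def)

text \<open>Modulo 2 the subset sums of a lattice basis are distinct, and there are only \<open>2^n\<close>
  residue classes.\<close>

lemma lattice_basis_card_le:
  fixes B :: "(real ^ 'n) set"
  assumes B: "lattice_basis B"
  shows "card B \<le> CARD('n)"
proof -
  have fin: "finite B" and sub: "B \<subseteq> int_lattice"
    using B by (auto simp: lattice_basis_def)
  \<comment> \<open>The coordinates in which the subset sum is even; this encodes its residue class
    modulo 2.\<close>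
  define g where "g S = {i. (\<Sum>b\<in>S. b) $ i / 2 \<in> \<int>}" for S :: "(real ^ 'n) set"
  have "inj_on g (Pow B)"
  proof (rule inj_onI)
    fix S T assume "S \<in> Pow B" "T \<in> Pow B" and g: "g S = g T"
    then have ST: "S \<subseteq> B" "T \<subseteq> B"
      by auto
    \<comment> \<open>Equal residues make half the difference a lattice vector. Its expansion in
      \<open>B\<close> shows that the indicators of \<open>S\<close> and \<open>T\<close> agree
      modulo 2, hence agree.\<close>
    define y where "y = (1/2) *\<^sub>R ((\<Sum>b\<in>S. b) - (\<Sum>b\<in>T. b))"
    have "y $ i \<in> \<int>" for i
    proof -
      have "(\<Sum>b\<in>S. b) $ i \<in> \<int>" "(\<Sum>b\<in>T. b) $ i \<in> \<int>"
        using ST sub unfolding int_lattice_def sum_component by (blast intro: Ints_sum)+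
      then obtain s t where st: "(\<Sum>b\<in>S. b) $ i = of_int s" "(\<Sum>b\<in>T. b) $ i = of_int t"
        by (auto elim!: Ints_cases)
      have half: "of_int k / (2::real) \<in> \<int> \<longleftrightarrow> even k" for k :: int
      proof
        assume "of_int k / (2::real) \<in> \<int>"
        then obtain m where "of_int k / (2::real) = of_int m"
          by (auto elim: Ints_cases)
        then have "(of_int k :: real) = of_int (2 * m)"
          by simp
        then show "even k"
          unfolding of_int_eq_iff by simp
      qed (auto elim!: evenE)
      have "of_int s / (2::real) \<in> \<int> \<longleftrightarrow> of_int t / (2::real) \<in> \<int>"
        using g st unfolding g_def by (metis (mono_tags, lifting) mem_Collect_eq)
      then have "even (s - t)"
        by (simp add: half)
      then show ?thesis
        using half[of "s - t"] st by (simp add: y_def)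
    qed
    then have "y \<in> int_lattice"
      by (simp add: int_lattice_def)
    then obtain c :: "_ \<Rightarrow> int" where c: "y = (\<Sum>b\<in>B. of_int (c b) *\<^sub>R b)"
      using B by (auto simp: lattice_basis_def)
    have ind: "(\<Sum>b\<in>B. of_int (of_bool (b \<in> U)) *\<^sub>R b) = (\<Sum>b\<in>U. b)" if "U \<subseteq> B" for U
      using fin that by (intro sum.mono_neutral_cong_right) auto
    have "(\<Sum>b\<in>B. of_int (of_bool (b \<in> S) - of_bool (b \<in> T) - 2 * c b) *\<^sub>R b)
        = (\<Sum>b\<in>S. b) - (\<Sum>b\<in>T. b) - 2 *\<^sub>R y"
      unfolding c ind[OF ST(1), symmetric] ind[OF ST(2), symmetric]
      by (simp add: scaleR_diff_left sum_subtractf scaleR_sum_right)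
    also have "\<dots> = 0"
      by (simp add: y_def)
    finally have *: "\<forall>b\<in>B. of_bool (b \<in> S) - of_bool (b \<in> T) - 2 * c b = 0"
      using B[unfolded lattice_basis_def, THEN conjunct2, THEN conjunct2, THEN conjunct1, THEN spec]
      by (rule mp[rotated])
    show "S = T"
    proof -
      have "b \<in> S \<longleftrightarrow> b \<in> T" if "b \<in> B" for b
        using bspec[OF * that] by (cases "b \<in> S"; cases "b \<in> T"; simp; presburger)
      with ST show ?thesis
        by blast
    qed
  qed
  then have "card (Pow B) \<le> card (Pow (UNIV :: 'n set))"
    by (rule card_inj_on_le) auto
  then show ?thesis
    by (simp add: card_Pow fin)
qed

lemma lattice_basis_span:
  fixes B :: "(real ^ 'n) set"
  assumes "lattice_basis B"
  shows "span B = UNIV"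
proof -
  have "axis i (1::real) \<in> span B" for i
  proof -
    obtain c :: "_ \<Rightarrow> int" where "axis i 1 = (\<Sum>b\<in>B. of_int (c b) *\<^sub>R b)"
      using assms int_lattice_axis[of i] by (auto simp: lattice_basis_def)
    then show ?thesis
      by (metis (no_types, lifting) span_base span_mul span_sum)
  qed
  then have "Basis \<subseteq> span B"
    by (auto simp: Basis_vec_def)
  then show ?thesis
    using span_minimal[of Basis "span B"] by (simp add: span_Basis top.extremum_unique)
qed

text \<open>The definition of \<open>lattice_basis\<close> speaks of integer relations only; this
  passes to real ones. As \<open>B\<close> spans, it contains a real basis with
  \<open>CARD('n)\<close> elements, and the cardinality bound leaves room for no more.\<close>

lemma lattice_basis_independent:
  fixes B :: "(real ^ 'n) set"
  assumes B: "lattice_basis B"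
  shows "independent B" "card B = CARD('n)"
proof -
  obtain C where C: "C \<subseteq> B" "independent C" "B \<subseteq> span C"
    using maximal_independent_subset by blast
  have fin: "finite B"
    using B by (auto simp: lattice_basis_def)
  have "span C = UNIV"
    using C(3) lattice_basis_span[OF B] by (metis span_minimal subspace_span top.extremum_unique)
  then have "card C = CARD('n)"
    using dim_eq_card_independent[OF C(2)] dim_span[of C] by (simp add: dim_UNIV)
  with fin C(1) lattice_basis_card_le[OF B] have "C = B"
    by (metis card_seteq)
  with C \<open>card C = _\<close> show "independent B" "card B = CARD('n)"
    by auto
qed

lemma lattice_basis_parallelogram:
  assumes B: "lattice_basis B" and mem: "b1 \<in> B" "b2 \<in> B" "b3 \<in> B" "b4 \<in> B"
    and eq: "b1 + b2 = b3 + b4"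
  shows "b1 = b3 \<or> b1 = b4"
proof (rule ccontr)
  assume *: "\<not> ?thesis"
  \<comment> \<open>Adding indicators makes coincidences such as \<open>b1 = b2\<close> harmless: if
    \<open>b1\<close> is neither \<open>b3\<close> nor \<open>b4\<close>, then \<open>c b1\<close>
    is 1 or 2.\<close>
  define c :: "_ \<Rightarrow> int"
    where "c x = of_bool (x = b1) + of_bool (x = b2) - of_bool (x = b3) - of_bool (x = b4)" for x
  have fin: "finite B"
    using B by (auto simp: lattice_basis_def)
  have delta: "(\<Sum>x\<in>B. of_int (of_bool (x = b)) *\<^sub>R x) = b" if "b \<in> B" for b
  proof -
    have "(\<Sum>x\<in>B. of_int (of_bool (x = b)) *\<^sub>R x) = (\<Sum>x\<in>B. if x = b then b else 0)"
      by (intro sum.cong) auto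
    then show ?thesis
      using fin that by simp
  qed
  have "(\<Sum>x\<in>B. of_int (c x) *\<^sub>R x) = b1 + b2 - b3 - b4"
    unfolding c_def of_int_add of_int_diff scaleR_add_left scaleR_diff_left sum.distrib sum_subtractf
    by (simp only: delta mem)
  also have "\<dots> = 0"
    using eq by simp
  finally have "c b1 = 0"
    using B mem(1) unfolding lattice_basis_def by blast
  then show False
    using * by (auto simp: c_def of_bool_def split: if_splits)
qed

section \<open>Smooth vertices\<close>

text \<open>What is kept of smoothness at a vertex \<open>w\<close>. It mentions no edges and tests
  only lattice points, so it is easy to transport along lattice automorphisms.\<close>

definition unimodular_at :: "(real ^ 'n) set \<Rightarrow> real ^ 'n \<Rightarrow> (real ^ 'n) set \<Rightarrow> bool" where
  "unimodular_at P w B \<longleftrightarrow> lattice_basis B \<and> (\<forall>b\<in>B. w + b \<in> P) \<and>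
     (\<forall>p\<in>P \<inter> int_lattice. \<exists>c :: real ^ 'n \<Rightarrow> nat. p - w = (\<Sum>b\<in>B. of_nat (c b) *\<^sub>R b))"

lemma extreme_point_of_lattice_polytope:
  "lattice_polytope P \<Longrightarrow> w extreme_point_of P \<Longrightarrow> w \<in> int_lattice"
  by (auto simp: lattice_polytope_def dest: extreme_point_of_convex_hull)

text \<open>Fix a coordinate with \<open>d $ i \<noteq> 0\<close>. For each admissible
  \<open>t\<close> the number \<open>t * \<bar>d $ i\<bar>\<close> is a positive integer, so there
  is a least admissible \<open>t\<close>; it is at most 1 because 1 is admissible.\<close>

lemma primitive_lattice_vector_exists:
  fixes d :: "real ^ 'n"
  assumes d: "d \<in> int_lattice" "d \<noteq> 0"
  obtains t where "0 < t" "t \<le> 1" "t *\<^sub>R d \<in> int_lattice"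
    "\<And>s. 0 < s \<Longrightarrow> s < 1 \<Longrightarrow> s *\<^sub>R t *\<^sub>R d \<notin> int_lattice"
proof -
  obtain i where i: "d $ i \<noteq> 0"
    using d(2) by (auto simp: vec_eq_iff)
  define m where "m t = nat \<lfloor>t * \<bar>d $ i\<bar>\<rfloor>" for t
  define S where "S = {t. 0 < t \<and> t *\<^sub>R d \<in> int_lattice}"
  have m: "real (m t) = t * \<bar>d $ i\<bar>" if t: "t \<in> S" for t
  proof -
    have "t * d $ i \<in> \<int>" "0 < t"
      using t by (auto simp: S_def int_lattice_def)
    then have "t * \<bar>d $ i\<bar> \<in> \<int>"
      by (metis Ints_abs abs_mult abs_of_pos)
    then show ?thesis
      using \<open>0 < t\<close> by (auto simp: m_def elim!: Ints_cases)
  qed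
  have "1 \<in> S"
    using d by (simp add: S_def)
  then obtain t where t: "t \<in> S" "\<And>s. s \<in> S \<Longrightarrow> m t \<le> m s"
    using arg_min_natI[of "\<lambda>t. t \<in> S" 1 m] arg_min_nat_le[of "\<lambda>t. t \<in> S" _ m] by blast
  have le: "t \<le> s" if "s \<in> S" for s
  proof -
    have "real (m t) \<le> real (m s)"
      using t(2)[OF that] by simp
    then show ?thesis
      using i m[OF t(1)] m[OF that] by simp
  qed
  show ?thesis
  proof (rule that)
    show "s *\<^sub>R t *\<^sub>R d \<notin> int_lattice" if s: "0 < s" "s < 1" for s
    proof
      assume "s *\<^sub>R t *\<^sub>R d \<in> int_lattice"
      then have "s * t \<in> S"
        using s t(1) by (auto simp: S_def)
      then show False
        using le[of "s * t"] s t(1) by (auto simp: S_def)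
    qed
  qed (use t le[OF \<open>1 \<in> S\<close>] in \<open>auto simp: S_def\<close>)
qed

text \<open>The other endpoint \<open>w'\<close> of \<open>E\<close> is a vertex of
  \<open>P\<close>, hence a lattice point, and the primitive vector towards it is an edge vector.
  Having dimension 1, \<open>E\<close> lies on the line through \<open>w\<close> and
  \<open>w'\<close>, and on one side of \<open>w\<close> since \<open>w\<close> is extreme.\<close>

lemma edge_subset_edge_vector_ray:
  fixes P :: "(real ^ 'n) set"
  assumes P: "lattice_polytope P" and w: "w extreme_point_of P"
    and E: "E edge_of P" "w \<in> E"
  obtains u where "u \<in> edge_vectors P w" "\<And>x. x \<in> E \<Longrightarrow> \<exists>s\<ge>0. x - w = s *\<^sub>R u"
proof -
  have "polytope P"
    using P by (auto simp: lattice_polytope_def polytope_def)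
  moreover have EP: "E face_of P" "aff_dim E = 1"
    using E by (auto simp: edge_of_def)
  ultimately have "polytope E"
    using face_of_polytope_polytope by blast
  then have conv: "convex E" and hull: "E = convex hull {v. v extreme_point_of E}"
    by (simp_all add: polytope_imp_convex Krein_Milman_Minkowski polytope_imp_compact)
  have "\<not> {v. v extreme_point_of E} \<subseteq> {w}"
  proof
    assume "{v. v extreme_point_of E} \<subseteq> {w}"
    then have "E \<subseteq> {w}"
      using hull by (metis convex_singleton hull_minimal)
    then have "E = {w}"
      using E(2) by auto
    then show False
      using EP(2) by simp
  qed
  then obtain w' where w': "w' extreme_point_of E" "w' \<noteq> w"
    by auto
  have wE: "w extreme_point_of E"
    using w E(2) EP(1) extreme_point_of_face by blast
  have lat: "w \<in> int_lattice" "w' \<in> int_lattice"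
    using extreme_point_of_lattice_polytope[OF P] w w'(1) EP(1) extreme_point_of_face by blast+
  have w'E: "w' \<in> E"
    using w'(1) by (auto simp: extreme_point_of_def)
  obtain t where t: "0 < t" "t \<le> 1" "t *\<^sub>R (w' - w) \<in> int_lattice"
    "\<And>s. 0 < s \<Longrightarrow> s < 1 \<Longrightarrow> s *\<^sub>R t *\<^sub>R (w' - w) \<notin> int_lattice"
    using primitive_lattice_vector_exists[of "w' - w"] int_lattice_diff lat w'(2) by auto
  have "(1 - t) *\<^sub>R w + t *\<^sub>R w' \<in> E"
    using convexD_alt[OF conv E(2) w'E, of t] t by auto
  then have "w + t *\<^sub>R (w' - w) \<in> E"
    by (simp add: algebra_simps)
  with t w'(2) have "first_lattice_vector w E (t *\<^sub>R (w' - w))"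
    unfolding first_lattice_vector_def by auto
  then have u: "t *\<^sub>R (w' - w) \<in> edge_vectors P w"
    using E by (auto simp: edge_vectors_def)
  have "affine hull {w, w'} = affine hull E"
    using w'(2) EP(2) E(2) w'E
    by (intro aff_dim_eq_full_gen[THEN iffD1]) (auto simp: aff_dim_2)
  then have aff: "E \<subseteq> affine hull {w, w'}"
    by (simp add: hull_subset)
  show ?thesis
  proof (rule that[OF u])
    fix x assume x: "x \<in> E"
    with aff obtain a b where ab: "x = a *\<^sub>R w + b *\<^sub>R w'" "a + b = 1"
      by (auto simp: affine_hull_2)
    have "a = 1 - b"
      using ab(2) by simp
    with ab(1) have xw: "x - w = b *\<^sub>R (w' - w)"
      by (simp add: algebra_simps)
    have "b \<ge> 0"
    proof (rule ccontr)
      assume "\<not> b \<ge> 0"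
      then have b: "b < 0"
        by simp
      \<comment> \<open>With this weight on \<open>x\<close>, the point \<open>w\<close> lies
        strictly between \<open>w'\<close> and \<open>x\<close>.\<close>
      define r where "r = 1 / (1 - b)"
      have r: "0 < r" "r < 1" "r * (1 - b) = 1"
        using b by (auto simp: r_def field_simps)
      have xb: "x = w + b *\<^sub>R (w' - w)"
        using xw by (simp add: algebra_simps)
      have "(1 - r) *\<^sub>R w' + r *\<^sub>R x = w + (1 - r * (1 - b)) *\<^sub>R (w' - w)"
        unfolding xb by (simp add: algebra_simps)
      then have "w = (1 - r) *\<^sub>R w' + r *\<^sub>R x"
        using r(3) by simp
      moreover have "x \<noteq> w'"
      proof
        assume "x = w'"
        then have "(1 - b) *\<^sub>R (w' - w) = 0"
          using xw by (simp add: algebra_simps)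
        then show False
          using b w'(2) by simp
      qed
      ultimately have "w \<in> open_segment w' x"
        using r by (auto simp: in_segment)
      then show False
        using wE x w'E by (auto simp: extreme_point_of_def)
    qed
    then show "\<exists>s\<ge>0. x - w = s *\<^sub>R t *\<^sub>R (w' - w)"
      using t(1) xw by (intro exI[of _ "b / t"]) auto
  qed
qed

text \<open>\<open>P\<close> translated by \<open>- w\<close> lies in the cone \<open>C\<close> over
  the edge vectors \<open>U\<close>. Full dimension forces \<open>U\<close> to span, so
  \<open>U\<close> is all of \<open>B\<close>. The nonnegative real coefficients of a lattice point
  are then its integer coordinates in \<open>B\<close>, hence natural numbers.\<close>

lemma smooth_polytope_unimodular_at:
  fixes P :: "(real ^ 'n) set"
  assumes P: "smooth_polytope P" and dim: "aff_dim P = int CARD('n)"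
    and w: "w extreme_point_of P"
  obtains B where "unimodular_at P w B"
proof -
  have lat: "lattice_polytope P"
    using P by (simp add: smooth_polytope_def)
  define U where "U = edge_vectors P w"
  obtain B where B: "lattice_basis B" and UB: "U \<subseteq> B"
    using P w by (auto simp: smooth_polytope_def U_def)
  have fin: "finite B"
    using B by (auto simp: lattice_basis_def)
  have wlat: "w \<in> int_lattice"
    using extreme_point_of_lattice_polytope[OF lat w] .
  define C where "C = {\<Sum>u\<in>U. c u *\<^sub>R u |c. \<forall>u. (0::real) \<le> c u}"
  have finU: "finite U"
    using UB fin finite_subset by blast
  have cone: "cone C"
    unfolding cone_def
  proof (intro ballI allI impI)
    fix x and a :: real assume "x \<in> C" and a: "a \<ge> 0"
    then obtain c where "x = (\<Sum>u\<in>U. c u *\<^sub>R u)" "\<forall>u. 0 \<le> c u"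
      by (auto simp: C_def)
    with a show "a *\<^sub>R x \<in> C"
      by (auto simp: C_def scaleR_sum_right intro!: exI[of _ "\<lambda>u. a * c u"])
  qed
  have plus: "x + y \<in> C" if x: "x \<in> C" and y: "y \<in> C" for x y
  proof -
    obtain c where "x = (\<Sum>u\<in>U. c u *\<^sub>R u)" "\<forall>u. 0 \<le> c u"
      using x by (auto simp: C_def)
    moreover obtain d where "y = (\<Sum>u\<in>U. d u *\<^sub>R u)" "\<forall>u. 0 \<le> d u"
      using y by (auto simp: C_def)
    ultimately show ?thesis
      by (auto simp: C_def scaleR_add_left sum.distrib intro!: exI[of _ "\<lambda>u. c u + d u"])
  qed
  have "convex C"
    using cone plus unfolding convex_def cone_def by auto
  have "0 \<in> C"
    by (auto simp: C_def intro!: exI[of _ "\<lambda>u. 0"])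
  have base: "u \<in> C" if "u \<in> U" for u
  proof -
    have "u = (\<Sum>x\<in>U. (if x = u then 1 else 0) *\<^sub>R x)"
      using that finU by (simp add: if_distrib[of "\<lambda>c. c *\<^sub>R _"] cong: if_cong)
    then show ?thesis
      unfolding C_def by (intro CollectI exI[of _ "\<lambda>x. if x = u then 1 else 0"]) auto
  qed
  have "x - w \<in> C" if E: "E edge_of P" "w \<in> E" "x \<in> E" for E x
  proof -
    obtain u where "u \<in> U" and "\<exists>s\<ge>0. x - w = s *\<^sub>R u"
      using edge_subset_edge_vector_ray[OF lat w E(1,2)] E(3) unfolding U_def by metis
    then show ?thesis
      using base cone by (auto simp: cone_def)
  qed
  moreover have "polytope P"
    using lat by (auto simp: lattice_polytope_def polytope_def)
  ultimately have PC: "p - w \<in> C" if "p \<in> P" for p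
    using polytope_subset_edge_cone[OF _ w \<open>convex C\<close> cone \<open>0 \<in> C\<close>] that by blast
  have "C \<subseteq> span U"
    unfolding C_def by (auto intro!: span_sum intro: span_mul span_base)
  then have "(\<lambda>x. x - w) ` P \<subseteq> span U"
    using PC by auto
  then have "dim ((\<lambda>x. x - w) ` P) \<le> dim U"
    using dim_subset dim_span by metis
  moreover have "aff_dim P = int (dim ((\<lambda>x. x - w) ` P))"
    using w by (intro aff_dim_eq_dim_subtract) (auto simp: extreme_point_of_def hull_inc)
  ultimately have "CARD('n) \<le> dim U"
    using dim by simp
  moreover have "independent U"
    using lattice_basis_independent(1)[OF B] UB independent_mono by blast
  ultimately have "CARD('n) \<le> card U"
    by (simp add: dim_eq_card_independent)
  then have eq: "U = B"
    using card_seteq[OF fin UB] lattice_basis_independent(2)[OF B] by simp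
  have "w + b \<in> P" if "b \<in> B" for b
    using that eq by (auto simp: U_def edge_vectors_def first_lattice_vector_def
        dest: edge_of_imp_subset)
  moreover have "\<exists>c :: real ^ 'n \<Rightarrow> nat. p - w = (\<Sum>b\<in>B. of_nat (c b) *\<^sub>R b)"
    if p: "p \<in> P" "p \<in> int_lattice" for p
  proof -
    obtain c where c: "p - w = (\<Sum>b\<in>B. c b *\<^sub>R b)" "\<And>u. (0::real) \<le> c u"
      using PC[OF p(1)] eq by (auto simp: C_def)
    obtain d :: "_ \<Rightarrow> int" where d: "p - w = (\<Sum>b\<in>B. of_int (d b) *\<^sub>R b)"
      using B int_lattice_diff[OF p(2) wlat] by (auto simp: lattice_basis_def)
    have "(\<Sum>b\<in>B. (c b - of_int (d b)) *\<^sub>R b) = 0"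
      using c(1) d by (simp add: scaleR_diff_left sum_subtractf)
    then have "c b - of_int (d b) = 0" if "b \<in> B" for b
      by (rule independentD[OF lattice_basis_independent(1)[OF B] fin subset_refl _ that])
    then have "of_nat (nat (d b)) = c b" if "b \<in> B" for b
      using that c(2)[of b] by simp
    then show ?thesis
      using c(1) by (intro exI[of _ "\<lambda>b. nat (d b)"]) simp
  qed
  ultimately have "unimodular_at P w B"
    using B by (auto simp: unimodular_at_def)
  then show ?thesis
    by (rule that)
qed

section \<open>Lattice coordinates and automorphisms\<close>

text \<open>\<open>M\<close> sends the unit vectors to \<open>B\<close>. It preserves the lattice
  because \<open>B\<close> is integral, and its inverse \<open>L\<close> does because
  \<open>B\<close> generates the lattice.\<close>

lemma lattice_basis_coordinates:
  fixes B :: "(real ^ 'n) set"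
  assumes B: "lattice_basis B"
  obtains L M \<sigma> where "linear L" "linear M" "\<And>x. L (M x) = x" "\<And>x. M (L x) = x"
    "\<And>x. x \<in> int_lattice \<Longrightarrow> L x \<in> int_lattice" "\<And>x. x \<in> int_lattice \<Longrightarrow> M x \<in> int_lattice"
    "bij_betw \<sigma> (UNIV :: 'n set) B" "\<And>i. L (\<sigma> i) = axis i 1"
proof -
  have fin: "finite B" and BZ: "B \<subseteq> int_lattice"
    using B by (auto simp: lattice_basis_def)
  obtain \<sigma> where \<sigma>: "bij_betw \<sigma> (UNIV :: 'n set) B"
    using finite_same_card_bij[of "UNIV :: 'n set" B] fin lattice_basis_independent(2)[OF B] by auto
  define M :: "real ^ 'n \<Rightarrow> real ^ 'n" where "M x = (\<Sum>i\<in>UNIV. x $ i *\<^sub>R \<sigma> i)" for x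
  have linM: "linear M"
    unfolding M_def
    by (intro linearI) (simp_all add: scaleR_add_left sum.distrib scaleR_sum_right)
  have Maxis: "M (axis i 1) = \<sigma> i" for i
    by (simp add: M_def axis_def if_distrib[of "\<lambda>c. c *\<^sub>R _"] cong: if_cong)
  have lat: "\<exists>y\<in>int_lattice. x = M y" if x: "x \<in> int_lattice" for x
  proof -
    obtain c :: "_ \<Rightarrow> int" where c: "x = (\<Sum>b\<in>B. of_int (c b) *\<^sub>R b)"
      using B x by (auto simp: lattice_basis_def)
    have "x = M (\<chi> i. of_int (c (\<sigma> i)))"
      unfolding c M_def using sum.reindex_bij_betw[OF \<sigma>, of "\<lambda>b. of_int (c b) *\<^sub>R b"] by simp
    then show ?thesis
      by (intro bexI) (auto simp: int_lattice_def)
  qed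
  have "span B \<subseteq> range M"
    using lat BZ by (intro span_minimal) (auto simp: linear_subspace_image[OF linM])
  then have "surj M"
    using lattice_basis_span[OF B] by auto
  then obtain L where L: "linear L" "\<And>x. L (M x) = x" "\<And>x. M (L x) = x"
    using linear_surjective_isomorphism[OF linM] by metis
  show ?thesis
  proof (rule that[OF L(1) linM L(2,3) _ _ \<sigma>])
    show "L x \<in> int_lattice" if "x \<in> int_lattice" for x
      using lat[OF that] L(2) by auto
    show "M x \<in> int_lattice" if x: "x \<in> int_lattice" for x
    proof -
      have "x $ i *\<^sub>R \<sigma> i \<in> int_lattice" for i
      proof -
        have "x $ i \<in> \<int>"
          using x by (simp add: int_lattice_def)
        then obtain k where "x $ i = of_int k"
          by (auto elim: Ints_cases)
        moreover have "\<sigma> i \<in> int_lattice"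
          using \<sigma> BZ by (auto simp: bij_betw_def)
        ultimately show ?thesis
          by (simp add: int_lattice_of_int_scaleR)
      qed
      then show ?thesis
        unfolding M_def by (rule int_lattice_sum)
    qed
    show "L (\<sigma> i) = axis i 1" for i
      using L(2)[of "axis i 1"] by (simp add: Maxis)
  qed
qed

locale lattice_automorphism =
  fixes L M :: "real ^ 'n \<Rightarrow> real ^ 'n"
  assumes linear: "linear L" "linear M"
    and inverse: "\<And>x. L (M x) = x" "\<And>x. M (L x) = x"
    and lattice: "\<And>x. x \<in> int_lattice \<Longrightarrow> L x \<in> int_lattice"
      "\<And>x. x \<in> int_lattice \<Longrightarrow> M x \<in> int_lattice"
begin

lemma bij_betw_int_lattice: "bij_betw L int_lattice int_lattice"
  using inverse lattice by (intro bij_betwI[of _ _ _ M]) auto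

lemma AGL_equivalent_image:
  assumes "v \<in> int_lattice"
  shows "AGL_equivalent P ((\<lambda>x. L (x - v)) ` P)"
proof -
  have "L (0 - v) \<in> int_lattice"
    using assms int_lattice_zero by (intro lattice int_lattice_diff)
  moreover have "(\<lambda>x. L (x - v)) = (\<lambda>x. L x + L (0 - v))"
    by (simp add: fun_eq_iff flip: linear_add[OF linear(1)])
  ultimately show ?thesis
    unfolding AGL_equivalent_def AGL_int_def using linear(1) bij_betw_int_lattice by blast
qed

lemma lattice_basis_image:
  assumes B: "lattice_basis B"
  shows "lattice_basis (L ` B)"
proof -
  have inj: "inj_on L B"
    using inverse by (metis inj_onI)
  have "\<exists>d :: _ \<Rightarrow> int. x = (\<Sum>b\<in>L ` B. of_int (d b) *\<^sub>R b)" if x: "x \<in> int_lattice" for x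
  proof -
    obtain c :: "_ \<Rightarrow> int" where "M x = (\<Sum>b\<in>B. of_int (c b) *\<^sub>R b)"
      using B lattice(2)[OF x] by (auto simp: lattice_basis_def)
    then have "x = L (\<Sum>b\<in>B. of_int (c b) *\<^sub>R b)"
      using inverse by metis
    then have "x = (\<Sum>b\<in>L ` B. of_int (c (M b)) *\<^sub>R b)"
      by (simp add: sum.reindex[OF inj] inverse linear_sum[OF linear(1)] linear_cmul[OF linear(1)])
    then show ?thesis
      by (intro exI[of _ "\<lambda>b. c (M b)"])
  qed
  moreover have "\<forall>b\<in>L ` B. d b = 0"
    if d: "(\<Sum>b\<in>L ` B. of_int (d b) *\<^sub>R b) = 0" for d :: "_ \<Rightarrow> int"
  proof -
    have "L (\<Sum>b\<in>B. of_int (d (L b)) *\<^sub>R b) = 0"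
      using d by (simp add: sum.reindex[OF inj] linear_sum[OF linear(1)] linear_cmul[OF linear(1)])
    then have "(\<Sum>b\<in>B. of_int (d (L b)) *\<^sub>R b) = 0"
      using inverse linear_0[OF linear(2)] by metis
    then show ?thesis
      using B[unfolded lattice_basis_def, THEN conjunct2, THEN conjunct2, THEN conjunct1,
          THEN spec[of _ "\<lambda>b. d (L b)"]] by auto
  qed
  ultimately show ?thesis
    using B lattice(1) by (auto simp: lattice_basis_def)
qed

text \<open>Carries the local condition at a vertex over to the normal form, so that smoothness
  itself need not be transported.\<close>

lemma unimodular_at_image:
  assumes P: "unimodular_at P w B" and v: "v \<in> int_lattice"
  shows "unimodular_at ((\<lambda>x. L (x - v)) ` P) (L (w - v)) (L ` B)"
  unfolding unimodular_at_def
proof (intro conjI ballI)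
  show "lattice_basis (L ` B)"
    using P lattice_basis_image by (simp add: unimodular_at_def)
  show "L (w - v) + b \<in> (\<lambda>x. L (x - v)) ` P" if b: "b \<in> L ` B" for b
  proof -
    obtain b' where b': "b = L b'" "b' \<in> B"
      using b by blast
    then have "w + b' \<in> P"
      using P by (simp add: unimodular_at_def)
    moreover have "L (w - v) + b = L (w + b' - v)"
      using linear_add[OF linear(1), of "w - v" b'] by (simp add: b'(1) algebra_simps)
    ultimately show ?thesis
      by blast
  qed
  fix p assume "p \<in> (\<lambda>x. L (x - v)) ` P \<inter> int_lattice"
  then obtain x where x: "x \<in> P" "p = L (x - v)" "p \<in> int_lattice"
    by blast
  have "x = M p + v"
    using x inverse by simp
  then have "x \<in> int_lattice"
    using int_lattice_add lattice(2) v x(3) by metis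
  then obtain c :: "_ \<Rightarrow> nat" where c: "x - w = (\<Sum>b\<in>B. of_nat (c b) *\<^sub>R b)"
    using P x(1) by (auto simp: unimodular_at_def)
  have "p - L (w - v) = L (x - w)"
    by (simp add: x(2) flip: linear_diff[OF linear(1)])
  also have "\<dots> = (\<Sum>b\<in>L ` B. of_nat (c (M b)) *\<^sub>R b)"
    unfolding c by (subst sum.reindex)
      (auto simp: inverse linear_sum[OF linear(1)] linear_cmul[OF linear(1)]
        intro: inj_on_inverseI[of _ M])
  finally show "\<exists>c :: _ \<Rightarrow> nat. p - L (w - v) = (\<Sum>b\<in>L ` B. of_nat (c b) *\<^sub>R b)"
    by (rule exI[of _ "\<lambda>b. c (M b)"])
qed

text \<open>The map is injective and affine, so an open segment around \<open>w'\<close> in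
  \<open>P\<close> would yield one around \<open>w\<close> in the image.\<close>

lemma extreme_point_of_image:
  assumes "w extreme_point_of ((\<lambda>x. L (x - v)) ` P)"
  obtains w' where "w' extreme_point_of P" "w = L (w' - v)"
proof -
  obtain w' where w': "w' \<in> P" "w = L (w' - v)"
    using assms by (auto simp: extreme_point_of_def)
  have "w \<in> open_segment (L (a - v)) (L (b - v))" if ab: "w' \<in> open_segment a b" for a b
  proof -
    obtain u where u: "a \<noteq> b" "0 < u" "u < 1" "w' = (1 - u) *\<^sub>R a + u *\<^sub>R b"
      using ab by (auto simp: in_segment)
    have "w' - v = (1 - u) *\<^sub>R (a - v) + u *\<^sub>R (b - v)"
      by (simp add: u(4) algebra_simps)
    then have "w = (1 - u) *\<^sub>R L (a - v) + u *\<^sub>R L (b - v)"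
      by (simp add: w'(2) linear_add[OF linear(1)] linear_cmul[OF linear(1)])
    moreover have "L (a - v) \<noteq> L (b - v)"
      using u(1) inverse(2) by (metis diff_left_imp_eq diff_right_commute right_minus_eq diff_add_cancel)
    ultimately show ?thesis
      using u by (auto simp: in_segment)
  qed
  then have "w' extreme_point_of P"
    using assms w'(1) by (auto simp: extreme_point_of_def)
  with w'(2) show ?thesis
    using that by blast
qed

lemma lattice_polytope_image:
  assumes P: "lattice_polytope P" and v: "v \<in> int_lattice"
  shows "lattice_polytope ((\<lambda>x. L (x - v)) ` P)"
proof -
  obtain V where V: "finite V" "V \<subseteq> int_lattice" "P = convex hull V"
    using P by (auto simp: lattice_polytope_def)
  have "(\<lambda>x. L (x - v)) ` P = L ` ((\<lambda>x. - v + x) ` P)"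
    by (auto simp: image_image)
  also have "\<dots> = convex hull (L ` ((\<lambda>x. - v + x) ` V))"
    unfolding V(3) convex_hull_translation[symmetric] convex_hull_linear_image[OF linear(1)] ..
  also have "L ` ((\<lambda>x. - v + x) ` V) = (\<lambda>x. L (x - v)) ` V"
    by (auto simp: image_image)
  finally show ?thesis
    unfolding lattice_polytope_def using V v
    by (intro exI[of _ "(\<lambda>x. L (x - v)) ` V"]) (auto intro!: lattice int_lattice_diff)
qed

end

section \<open>Peaks of linear functionals\<close>

text \<open>The generators other than \<open>w\<close> lie in the open half-space below the value at
  \<open>w\<close>, hence so does their hull. A point outside the hull of the other generators is
  extreme.\<close>

lemma peak_extreme_point:
  assumes P: "lattice_polytope P" and w: "w \<in> P"
    and peak: "\<And>p. p \<in> P \<inter> int_lattice \<Longrightarrow> p \<noteq> w \<Longrightarrow> a \<bullet> p < a \<bullet> w"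
  shows "w extreme_point_of P"
proof -
  obtain V where V: "finite V" "V \<subseteq> int_lattice" "P = convex hull V"
    using P by (auto simp: lattice_polytope_def)
  have "V - {w} \<subseteq> {x. a \<bullet> x < a \<bullet> w}"
    using peak V by (auto simp: hull_inc)
  then have "convex hull (V - {w}) \<subseteq> {x. a \<bullet> x < a \<bullet> w}"
    by (intro hull_minimal convex_halfspace_lt)
  then have "w extreme_point_of (convex hull (insert w (V - {w})))"
    using V(1) by (intro extreme_point_of_convex_hull_insert) auto
  moreover have "convex hull (insert w V) = P"
    using w V(3) hull_redundant by metis
  ultimately show ?thesis
    by simp
qed

locale unimodular_peak =
  fixes P :: "(real ^ 'n) set" and w B a
  assumes unimodular: "unimodular_at P w B"
    and lattice: "w \<in> int_lattice" "a \<in> int_lattice"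
    and peak: "\<And>p. p \<in> P \<inter> int_lattice \<Longrightarrow> p \<noteq> w \<Longrightarrow> a \<bullet> p < a \<bullet> w"
begin

lemma lattice_basis: "lattice_basis B"
  using unimodular by (simp add: unimodular_at_def)

lemma peak_diff: "p \<in> P \<inter> int_lattice \<Longrightarrow> p \<noteq> w \<Longrightarrow> a \<bullet> (w - p) \<ge> 1"
proof -
  assume p: "p \<in> P \<inter> int_lattice" "p \<noteq> w"
  then have "a \<bullet> (w - p) \<in> \<int>"
    by (intro int_lattice_inner int_lattice_diff lattice) auto
  moreover have "a \<bullet> (w - p) > 0"
    using peak[OF p] by (simp add: inner_diff_right)
  ultimately show ?thesis
    by (auto elim!: Ints_cases)
qed

text \<open>For \<open>b\<close> in \<open>B\<close>, the point \<open>w + b\<close> is a lattice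
  point of \<open>P\<close> other than \<open>w\<close>, so by integrality \<open>a\<close> drops by
  at least 1 along \<open>b\<close>. The total drop therefore bounds the number of basis steps,
  counted with multiplicity.\<close>

lemma coefficient_sum_le:
  assumes "p - w = (\<Sum>b\<in>B. of_nat (c b) *\<^sub>R b)"
  shows "real (\<Sum>b\<in>B. c b) \<le> a \<bullet> (w - p)"
proof -
  have "a \<bullet> b \<le> -1" if b: "b \<in> B" for b
  proof -
    have "w + b \<in> P \<inter> int_lattice"
      using b unimodular lattice(1)
      by (auto simp: unimodular_at_def lattice_basis_def intro: int_lattice_add)
    moreover have "b \<noteq> 0"
      using b lattice_basis_independent(1)[OF lattice_basis] dependent_zero by blast
    ultimately show ?thesis
      using peak_diff[of "w + b"] by simp
  qed
  then have "real (c b) \<le> real (c b) * (- (a \<bullet> b))" if "b \<in> B" for b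
    using mult_left_mono[of 1 "- (a \<bullet> b)" "real (c b)"] that by force
  then have "real (\<Sum>b\<in>B. c b) \<le> (\<Sum>b\<in>B. real (c b) * (- (a \<bullet> b)))"
    unfolding of_nat_sum by (rule sum_mono)
  also have "\<dots> = - (a \<bullet> (p - w))"
    by (simp add: assms inner_sum_right sum_negf)
  finally show ?thesis
    by (simp add: inner_diff_right)
qed

text \<open>A drop of 1 pays for at most one basis vector, and \<open>p \<noteq> w\<close> requires
  at least one.\<close>

lemma neighbour_in_basis:
  assumes p: "p \<in> P \<inter> int_lattice" and one: "a \<bullet> (w - p) = 1"
  shows "p - w \<in> B"
proof -
  obtain c :: "_ \<Rightarrow> nat" where c: "p - w = (\<Sum>b\<in>B. of_nat (c b) *\<^sub>R b)"
    using unimodular p by (auto simp: unimodular_at_def)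
  have fin: "finite B"
    using lattice_basis by (auto simp: lattice_basis_def)
  have "p \<noteq> w"
    using one by auto
  moreover have "p - w = 0" if "(\<Sum>b\<in>B. c b) = 0"
    using that fin by (simp add: c)
  ultimately have "(\<Sum>b\<in>B. c b) \<noteq> 0"
    by auto
  moreover have "(\<Sum>b\<in>B. c b) \<le> 1"
    using coefficient_sum_le[OF c] one by linarith
  ultimately have "(\<Sum>b\<in>B. c b) = Suc 0"
    by linarith
  with fin obtain b where b: "b \<in> B" "c b = Suc 0" "\<forall>x\<in>B. b \<noteq> x \<longrightarrow> c x = 0"
    by (auto simp: sum_eq_Suc0_iff)
  have "p - w = (\<Sum>x\<in>B. if x = b then b else 0)"
    unfolding c using b by (intro sum.cong) auto
  then show ?thesis
    using b(1) fin by simp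
qed

text \<open>Subtracting \<open>w\<close> from each point leaves a relation between four elements of
  \<open>B\<close>.\<close>

lemma neighbour_parallelogram:
  assumes "p \<in> P \<inter> int_lattice" "q \<in> P \<inter> int_lattice" "r \<in> P \<inter> int_lattice" "s \<in> P \<inter> int_lattice"
    and "a \<bullet> (w - p) = 1" "a \<bullet> (w - q) = 1" "a \<bullet> (w - r) = 1" "a \<bullet> (w - s) = 1"
    and eq: "p + q = r + s"
  shows "p = r \<or> p = s"
  using lattice_basis_parallelogram[OF lattice_basis, of "p - w" "q - w" "r - w" "s - w"]
    neighbour_in_basis[of p] neighbour_in_basis[of q] neighbour_in_basis[of r]
    neighbour_in_basis[of s] assms by (auto simp: algebra_simps)

end

section \<open>Lattice points of \<open>2\<Delta>\<^sub>n\<close> and the normal form\<close>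

lemma convex_dilated_simplex: "convex (dilated_simplex c :: (real ^ 'n) set)"
proof -
  have "(dilated_simplex c :: (real ^ 'n) set) = (\<Inter>i. {x. 0 \<le> axis i 1 \<bullet> x}) \<inter> {x. (\<chi> i. 1) \<bullet> x \<le> c}"
    by (auto simp: dilated_simplex_def inner_axis') (simp_all add: inner_vec_def)
  then show ?thesis
    by (simp only:) (intro convex_Int convex_INT convex_halfspace_le convex_halfspace_ge)
qed

lemma int_lattice_ge_1:
  assumes "x \<in> int_lattice" "x $ i > 0"
  shows "x $ i \<ge> 1"
proof -
  have "x $ i \<in> \<int>"
    using assms by (simp add: int_lattice_def)
  then show ?thesis
    using assms(2) by (auto elim!: Ints_cases)
qed

text \<open>A nonzero coordinate of a lattice point in the orthant is at least 1, so a unit vector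
  can be subtracted; this lowers the coordinate sum by 1.\<close>

lemma dilated_simplex_lattice_descent:
  assumes x: "x \<in> int_lattice" "x \<in> dilated_simplex c" "x \<noteq> 0"
  obtains i where "x - axis i 1 \<in> int_lattice" "x - axis i 1 \<in> dilated_simplex (c - 1)"
proof -
  obtain i where "x $ i \<noteq> 0"
    using x(3) by (auto simp: vec_eq_iff)
  then have "x $ i > 0"
    using x(2) by (auto simp: dilated_simplex_def less_le)
  then have i: "x $ i \<ge> 1"
    using int_lattice_ge_1 x(1) by blast
  have "(\<Sum>j\<in>UNIV. axis i 1 $ j) = (1::real)"
    by (simp add: axis_def)
  then have "x - axis i 1 \<in> dilated_simplex (c - 1)"
    using x(2) i unfolding dilated_simplex_def
    by (auto simp: sum_subtractf axis_def)
  then show ?thesis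
    using that int_lattice_diff[OF x(1) int_lattice_axis] by blast
qed

lemma dilated_simplex_0: "x \<in> dilated_simplex 0 \<Longrightarrow> x = 0"
  using sum_nonneg_eq_0_iff[of UNIV "\<lambda>i. x $ i"] sum_nonneg[of UNIV "\<lambda>i. x $ i"]
  by (auto simp: dilated_simplex_def vec_eq_iff)

text \<open>At most two descents lead to 0, the only point of
  \<open>dilated_simplex 0\<close>.\<close>

lemma dilated_simplex_2_lattice_cases:
  fixes x :: "real ^ 'n"
  assumes x: "x \<in> int_lattice" "x \<in> dilated_simplex 2"
  obtains "x = 0" | i where "x = axis i 1" | i j where "x = axis i 1 + axis j 1"
proof (cases "x = 0")
  case False
  then obtain i where i: "x - axis i 1 \<in> int_lattice" "x - axis i 1 \<in> dilated_simplex (2 - 1)"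
    using dilated_simplex_lattice_descent x by metis
  show ?thesis
  proof (cases "x - axis i 1 = 0")
    case False
    then obtain j where "x - axis i 1 - axis j 1 \<in> dilated_simplex (2 - 1 - 1)"
      using dilated_simplex_lattice_descent i by metis
    then have "x - axis i 1 - axis j 1 = 0"
      by (intro dilated_simplex_0) simp
    then have "x = axis i 1 + axis j 1"
      by (simp add: algebra_simps)
    then show ?thesis
      by (rule that(3))
  qed (use that(2) in simp)
qed (use that(1) in simp)

lemma axis_1_nth: "axis i (1::real) $ j = (if i = j then 1 else 0)"
  by (simp add: axis_def)

lemma inner_axis_1: "(a :: real ^ 'n) \<bullet> axis i 1 = a $ i" "axis i 1 \<bullet> a = a $ i"
  by (simp_all add: inner_axis inner_axis')

lemmas axis_simps = axis_1_nth inner_axis_1 inner_add_left inner_add_right inner_diff_left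
  inner_diff_right

text \<open>If \<open>P\<close> contains a vertex of \<open>2\<Delta>\<^sub>n\<close>, that vertex is a peak of depth 2.  Otherwise every
  lattice point is the midpoint of an edge of \<open>2\<Delta>\<^sub>n\<close>, and the sum of the two homogeneous
  coordinates of that edge works.\<close>

lemma lattice_peak_exists:
  fixes P :: "(real ^ 'n) set"
  assumes P: "lattice_polytope P" "P \<noteq> {}" "P \<subseteq> dilated_simplex 2"
  obtains v a where "v \<in> P" "v \<in> int_lattice" "a \<in> int_lattice"
    "\<And>p. p \<in> P \<inter> int_lattice \<Longrightarrow> p \<noteq> v \<Longrightarrow> a \<bullet> p < a \<bullet> v"
    "\<And>p. p \<in> P \<inter> int_lattice \<Longrightarrow> a \<bullet> (v - p) \<le> 2"
proof -
  have cases: thesis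
    if p: "p \<in> P \<inter> int_lattice" and "p = 0 \<Longrightarrow> thesis" "\<And>i. p = axis i 1 \<Longrightarrow> thesis"
      "\<And>i j. p = axis i 1 + axis j 1 \<Longrightarrow> thesis" for p thesis
    using dilated_simplex_2_lattice_cases[of p] that P(3) by blast
  show ?thesis
  proof (cases "0 \<in> P")
    case True
    show ?thesis
    proof (rule that[OF True int_lattice_zero])
      \<comment> \<open>At the vertex 0 the functional is minus the coordinate sum.\<close>
      show "(\<chi> i. - 1) \<in> (int_lattice :: (real ^ 'n) set)"
        by (simp add: int_lattice_def)
      fix p assume "p \<in> P \<inter> int_lattice"
      note p = this
      show "(\<chi> i. - 1) \<bullet> (0 - p) \<le> 2"
        using p by (rule cases) (auto simp: axis_simps)
      show "(\<chi> i. - 1) \<bullet> p < (\<chi> i. - 1) \<bullet> (0 :: real ^ 'n)" if "p \<noteq> 0"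
        using p by (rule cases) (use that in \<open>auto simp: axis_simps\<close>)
    qed
  next
    case no0: False
    show ?thesis
    proof (cases "\<exists>i. axis i 1 + axis i 1 \<in> P")
      case True
      then obtain i where i: "axis i 1 + axis i 1 \<in> P"
        by blast
      show ?thesis
      proof (rule that[OF i int_lattice_add[OF int_lattice_axis int_lattice_axis] int_lattice_axis])
        fix p assume p: "p \<in> P \<inter> int_lattice"
        then show "axis i 1 \<bullet> (axis i 1 + axis i 1 - p) \<le> 2"
          using P(3) by (auto simp: axis_simps dilated_simplex_def)
        show "axis i 1 \<bullet> p < axis i 1 \<bullet> (axis i 1 + axis i 1 :: real ^ 'n)"
          if "p \<noteq> axis i 1 + axis i 1"
          using p by (rule cases) (use that in \<open>auto simp: axis_simps\<close>)
      qed
    next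
      case no2: False
      obtain v where v: "v \<in> P \<inter> int_lattice"
        using P(1,2) hull_inc unfolding lattice_polytope_def
        by (metis IntI convex_hull_empty ex_in_conv subsetD)
      from v show ?thesis
      proof (rule cases)
        fix i assume vi: "v = axis i 1"
        \<comment> \<open>The homogeneous coordinates of the edge from 0 to
          \<open>2e\<^sub>i\<close> are \<open>x $ i\<close> and 2 minus the coordinate sum; up to
          the constant 2 the functional is their sum. Besides \<open>v\<close> it is maximal only at
          the lattice points 0 and \<open>2e\<^sub>i\<close>, both absent.\<close>
        show ?thesis
        proof (rule that[of v "axis i 1 - (\<chi> i. 1)"])
          fix p assume p: "p \<in> P \<inter> int_lattice"
          then show "(axis i 1 - (\<chi> i. 1)) \<bullet> (v - p) \<le> 2"
            by (rule cases)
              (auto simp: vi axis_simps)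
          show "(axis i 1 - (\<chi> i. 1)) \<bullet> p < (axis i 1 - (\<chi> i. 1)) \<bullet> v" if "p \<noteq> v"
            using p by (rule cases) (use p that no0 no2 in \<open>auto simp: vi axis_simps\<close>)
        qed (use v in \<open>auto simp: int_lattice_def axis_def\<close>)
      next
        fix i j assume vij: "v = axis i 1 + axis j 1"
        then have "i \<noteq> j"
          using v no2 by auto
        \<comment> \<open>On the edge from \<open>2e\<^sub>i\<close> to \<open>2e\<^sub>j\<close>
          the two coordinates are \<open>x $ i\<close> and \<open>x $ j\<close>, so \<open>v\<close>
          itself serves as the functional.\<close>
        show ?thesis
        proof (rule that[of v v])
          fix p assume p: "p \<in> P \<inter> int_lattice"
          have "v \<bullet> p = p $ i + p $ j"
            by (simp add: vij axis_simps)
          moreover have "0 \<le> p $ i" "0 \<le> p $ j"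
            using p P(3) by (auto simp: dilated_simplex_def)
          moreover have vv: "v \<bullet> v = 2"
            using \<open>i \<noteq> j\<close> by (simp add: vij axis_simps)
          ultimately show "v \<bullet> (v - p) \<le> 2"
            by (simp add: inner_diff_right)
          show "v \<bullet> p < v \<bullet> v" if "p \<noteq> v"
            unfolding vv using p
            by (rule cases)
              (use p that no0 no2 \<open>i \<noteq> j\<close> in \<open>auto simp: vij axis_simps add.commute\<close>)
        qed (use v in auto)
      qed (use v no0 in auto)
    qed
  qed
qed

lemma smooth_polytope_normal_form:
  fixes P :: "(real ^ 'n) set"
  assumes P: "smooth_polytope P" and dim: "aff_dim P = int CARD('n)"
    and sub: "P \<subseteq> dilated_simplex 2"
  obtains Q where "AGL_equivalent P Q" "lattice_polytope Q" "Q \<subseteq> dilated_simplex 2"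
    "0 \<in> Q" "\<And>i. axis i 1 \<in> Q"
    "\<And>w. w extreme_point_of Q \<Longrightarrow> \<exists>B. unimodular_at Q w B"
proof -
  have lat: "lattice_polytope P"
    using P by (simp add: smooth_polytope_def)
  have "P \<noteq> {}"
    using dim by auto
  then obtain v a where v: "v \<in> P" "v \<in> int_lattice" and a: "a \<in> int_lattice"
    "\<And>p. p \<in> P \<inter> int_lattice \<Longrightarrow> p \<noteq> v \<Longrightarrow> a \<bullet> p < a \<bullet> v"
    and two: "\<And>p. p \<in> P \<inter> int_lattice \<Longrightarrow> a \<bullet> (v - p) \<le> 2"
    using lattice_peak_exists[OF lat _ sub] by metis
  have "v extreme_point_of P"
    using peak_extreme_point[OF lat v(1)] a(2) by blast
  then obtain B where B: "unimodular_at P v B"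
    using smooth_polytope_unimodular_at[OF P dim] by blast
  interpret peak: unimodular_peak P v B a
    using B v a by unfold_locales auto
  obtain L M \<sigma> where LM: "linear L" "linear M" "\<And>x. L (M x) = x" "\<And>x. M (L x) = x"
    "\<And>x. x \<in> int_lattice \<Longrightarrow> L x \<in> int_lattice" "\<And>x. x \<in> int_lattice \<Longrightarrow> M x \<in> int_lattice"
    and \<sigma>: "bij_betw \<sigma> (UNIV :: 'n set) B" "\<And>i. L (\<sigma> i) = axis i 1"
    using lattice_basis_coordinates[OF peak.lattice_basis] by metis
  interpret lattice_automorphism L M
    by (intro lattice_automorphism.intro LM)
  define f where "f = (\<lambda>x. L (x - v))"
  have latQ: "lattice_polytope (f ` P)"
    using lattice_polytope_image[OF lat v(2)] by (simp add: f_def)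
  then obtain V where V: "V \<subseteq> int_lattice" "f ` P = convex hull V"
    by (auto simp: lattice_polytope_def)
  \<comment> \<open>By convexity it suffices to treat the generators. The coordinates of the image
    of \<open>p\<close> are the coefficients of \<open>p - v\<close> in \<open>B\<close>, and their
    sum is at most the drop from \<open>v\<close> to \<open>p\<close>, which is at most 2.\<close>
  have "V \<subseteq> dilated_simplex 2"
  proof
    fix x assume x: "x \<in> V"
    then have "x \<in> f ` P" "x \<in> int_lattice"
      using V by (auto simp: hull_inc)
    then obtain p where p: "p \<in> P" "x = L (p - v)"
      by (auto simp: f_def)
    have "p = M x + v"
      using p inverse by simp
    then have pP: "p \<in> P \<inter> int_lattice"
      using p(1) LM(6)[OF \<open>x \<in> int_lattice\<close>] v(2) int_lattice_add by blast
    then obtain c :: "_ \<Rightarrow> nat" where c: "p - v = (\<Sum>b\<in>B. of_nat (c b) *\<^sub>R b)"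
      using B by (auto simp: unimodular_at_def)
    also have "\<dots> = (\<Sum>i\<in>UNIV. of_nat (c (\<sigma> i)) *\<^sub>R \<sigma> i)"
      using sum.reindex_bij_betw[OF \<sigma>(1), of "\<lambda>b. of_nat (c b) *\<^sub>R b"] by simp
    finally have "x = (\<Sum>i\<in>UNIV. of_nat (c (\<sigma> i)) *\<^sub>R axis i 1)"
      by (simp add: p(2) linear_sum[OF LM(1)] linear_cmul[OF LM(1)] \<sigma>(2))
    then have xi: "x $ i = real (c (\<sigma> i))" for i
      by (simp add: axis_def if_distrib[of "\<lambda>c. _ * c"] cong: if_cong)
    have "real (\<Sum>b\<in>B. c b) \<le> 2"
      using peak.coefficient_sum_le[OF c] two[OF pP] by linarith
    also have "(\<Sum>b\<in>B. c b) = (\<Sum>i\<in>UNIV. c (\<sigma> i))"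
      using sum.reindex_bij_betw[OF \<sigma>(1), of c] by simp
    finally show "x \<in> dilated_simplex 2"
      by (simp add: dilated_simplex_def xi)
  qed
  then have subQ: "f ` P \<subseteq> dilated_simplex 2"
    unfolding V(2) by (intro hull_minimal convex_dilated_simplex)
  have "0 \<in> f ` P"
    using v(1) linear_0[OF LM(1)] by (force simp: f_def)
  moreover have "axis i 1 \<in> f ` P" for i
  proof -
    have "v + \<sigma> i \<in> P"
      using B \<sigma>(1) by (auto simp: unimodular_at_def bij_betw_def)
    then show ?thesis
      using \<sigma>(2) by (auto simp: f_def intro!: image_eqI[of _ _ "v + \<sigma> i"])
  qed
  moreover have "\<exists>B. unimodular_at (f ` P) w B" if w: "w extreme_point_of (f ` P)" for w
  proof -
    obtain w' where w': "w' extreme_point_of P" "w = L (w' - v)"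
      using w unfolding f_def by (rule extreme_point_of_image)
    obtain B' where "unimodular_at P w' B'"
      using smooth_polytope_unimodular_at[OF P dim w'(1)] .
    then show ?thesis
      using unimodular_at_image[OF _ v(2)] unfolding f_def w'(2) by blast
  qed
  moreover have "AGL_equivalent P (f ` P)"
    unfolding f_def by (rule AGL_equivalent_image[OF v(2)])
  ultimately show ?thesis
    using that latQ subQ by blast
qed

section \<open>Polytopes between \<open>\<Delta>\<^sub>n\<close> and
  \<open>2\<Delta>\<^sub>n\<close> and their graphs\<close>

text \<open>Unimodularity is left to an extension of this locale, so that the model polytopes can be
  compared with \<open>Q\<close> without proving it for them.\<close>

locale sandwiched_polytope =
  fixes Q :: "(real ^ 'n) set"
  assumes lattice_polytope: "lattice_polytope Q"
    and subset: "Q \<subseteq> dilated_simplex 2"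
    and zero: "0 \<in> Q"
    and axis: "\<And>i. axis i 1 \<in> Q"
begin

definition adj :: "'n \<Rightarrow> 'n \<Rightarrow> bool" where
  "adj i j \<longleftrightarrow> axis i 1 + axis j 1 \<in> Q"

lemma adj_sym: "adj i j \<longleftrightarrow> adj j i"
  by (simp add: adj_def add.commute)

lemma lattice_point_cases:
  assumes "p \<in> Q \<inter> int_lattice"
  obtains "p = 0" | i where "p = axis i 1" | i j where "p = axis i 1 + axis j 1" "adj i j"
  using assms subset dilated_simplex_2_lattice_cases[of p thesis] by (auto simp: adj_def)

lemma lattice_points:
  "0 \<in> Q \<inter> int_lattice" "axis i 1 \<in> Q \<inter> int_lattice"
  "adj i j \<Longrightarrow> axis i 1 + axis j 1 \<in> Q \<inter> int_lattice"
  by (auto simp: zero axis adj_def intro: int_lattice_zero int_lattice_axis int_lattice_add)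

lemma eq_convex_hull: "Q = convex hull (Q \<inter> int_lattice)"
proof
  obtain V where V: "V \<subseteq> int_lattice" "Q = convex hull V"
    using lattice_polytope by (auto simp: lattice_polytope_def)
  then have "V \<subseteq> Q \<inter> int_lattice"
    by (auto simp: hull_inc)
  then show "Q \<subseteq> convex hull (Q \<inter> int_lattice)"
    using V(2) hull_mono by blast
  show "convex hull (Q \<inter> int_lattice) \<subseteq> Q"
    using V(2) by (intro hull_minimal) auto
qed

text \<open>\<open>e\<^sub>i + e\<^sub>j\<close> is the midpoint of \<open>2e\<^sub>i\<close> and
  \<open>2e\<^sub>j\<close>.\<close>

lemma adj_diagonal:
  assumes "adj i i" "adj j j"
  shows "adj i j"
proof -
  have "convex Q"
    using lattice_polytope by (auto simp: lattice_polytope_def)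
  then have "(1/2) *\<^sub>R (axis i 1 + axis i 1) + (1/2) *\<^sub>R (axis j 1 + axis j 1) \<in> Q"
    using assms by (intro convexD) (auto simp: adj_def)
  then show ?thesis
    by (simp add: adj_def flip: scaleR_2)
qed

end

text \<open>Both polytopes contain 0 and all \<open>e\<^sub>i\<close>. The graph decides the
  remaining lattice points, and each polytope is the hull of its lattice points.\<close>

lemma sandwiched_polytope_eqI:
  assumes "sandwiched_polytope Q" "sandwiched_polytope T"
    and adj: "\<And>i j. sandwiched_polytope.adj Q i j \<longleftrightarrow> sandwiched_polytope.adj T i j"
  shows "Q = T"
proof -
  interpret Q: sandwiched_polytope Q by fact
  interpret T: sandwiched_polytope T by fact
  have "p \<in> T \<inter> int_lattice" if "p \<in> Q \<inter> int_lattice" for p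
    using that by (rule Q.lattice_point_cases) (auto simp del: Int_iff simp: adj T.lattice_points)
  moreover have "p \<in> Q \<inter> int_lattice" if "p \<in> T \<inter> int_lattice" for p
    using that by (rule T.lattice_point_cases) (auto simp del: Int_iff simp: Q.lattice_points simp flip: adj)
  ultimately have "Q \<inter> int_lattice = T \<inter> int_lattice"
    by blast
  then show ?thesis
    using Q.eq_convex_hull T.eq_convex_hull by simp
qed

locale unimodular_sandwiched_polytope = sandwiched_polytope Q for Q :: "(real ^ 'n) set" +
  assumes unimodular: "\<And>w. w extreme_point_of Q \<Longrightarrow> \<exists>B. unimodular_at Q w B"
begin

text \<open>A peak is a vertex, where unimodularity supplies the basis. The graph arguments then
  only have to exhibit a peak and a relation one level below it.\<close>

lemma peak_parallelogram:
  assumes "w \<in> Q \<inter> int_lattice" "a \<in> int_lattice"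
    and peak: "\<And>p. p \<in> Q \<inter> int_lattice \<Longrightarrow> p \<noteq> w \<Longrightarrow> a \<bullet> p < a \<bullet> w"
    and mem: "p \<in> Q \<inter> int_lattice" "q \<in> Q \<inter> int_lattice" "r \<in> Q \<inter> int_lattice" "s \<in> Q \<inter> int_lattice"
    and one: "a \<bullet> (w - p) = 1" "a \<bullet> (w - q) = 1" "a \<bullet> (w - r) = 1" "a \<bullet> (w - s) = 1"
    and eq: "p + q = r + s"
  shows "p = r \<or> p = s"
proof -
  have "w extreme_point_of Q"
    using peak_extreme_point[OF lattice_polytope _ peak] assms(1) by blast
  then obtain B where "unimodular_at Q w B"
    using unimodular by blast
  then interpret unimodular_peak Q w B a
    using assms(1,2) peak by unfold_locales auto
  show ?thesis
    using neighbour_parallelogram[OF mem one eq] .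
qed

text \<open>If \<open>i\<close> and \<open>k\<close> were adjacent, then
  \<open>0 + (e\<^sub>i + e\<^sub>k) = e\<^sub>i + e\<^sub>k\<close> would be a relation between
  points one level below the peak \<open>e\<^sub>j\<close>.\<close>

lemma not_adj_trans:
  assumes jj: "\<not> adj j j" and ji: "\<not> adj j i" and jk: "\<not> adj j k"
  shows "\<not> adj i k"
proof
  assume ik: "adj i k"
  \<comment> \<open>Among the other lattice points of \<open>2\<Delta>\<^sub>n\<close>, only the
    sums of \<open>e\<^sub>j\<close> with \<open>e\<^sub>i\<close>, \<open>e\<^sub>j\<close> or
    \<open>e\<^sub>k\<close> reach the value at \<open>e\<^sub>j\<close>, and the hypotheses keep
    these out of \<open>Q\<close>.\<close>
  define a :: "real ^ 'n" where "a = (\<chi> l. if l = j then 1 else if l = i \<or> l = k then 0 else - 1)"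
  have nth: "a $ l = (if l = j then 1 else if l = i \<or> l = k then 0 else - 1)" for l
    by (simp add: a_def)
  have ne: "i \<noteq> j" "k \<noteq> j"
    using ik ji jk adj_sym by auto
  have "0 = (axis i 1 :: real ^ 'n) \<or> 0 = (axis k 1 :: real ^ 'n)"
  proof (rule peak_parallelogram[of "axis j 1" a 0 "axis i 1 + axis k 1"])
    show "a \<in> int_lattice"
      by (simp add: int_lattice_def nth)
    show "a \<bullet> p < a \<bullet> axis j 1" if p: "p \<in> Q \<inter> int_lattice" "p \<noteq> axis j 1" for p
      using p(1)
    proof (rule lattice_point_cases)
      fix l m assume lm: "p = axis l 1 + axis m 1" "adj l m"
      have "\<not> (l = j \<and> m \<in> {i, j, k})" "\<not> (m = j \<and> l \<in> {i, j, k})"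
        using lm(2) jj ji jk adj_sym by blast+
      then show ?thesis
        by (auto simp: lm(1) axis_simps nth)
    qed (use p(2) in \<open>auto simp: axis_simps nth\<close>)
  qed (use ik lattice_points ne in \<open>auto simp: axis_simps nth simp del: Int_iff\<close>)
  then show False
    by (simp add: axis_eq_0_iff)
qed

text \<open>A common neighbour \<open>i\<close> gives \<open>e\<^sub>j + (e\<^sub>i + e\<^sub>k) =
  e\<^sub>k + (e\<^sub>i + e\<^sub>j)\<close> one level below \<open>e\<^sub>j + e\<^sub>k\<close>.
  That point is a peak of \<open>x $ j + x $ k\<close> because \<open>2e\<^sub>j\<close> and
  \<open>2e\<^sub>k\<close>, with the same value, are absent.\<close>

lemma no_common_neighbour:
  assumes jk: "j \<noteq> k" "adj j k" and jj: "\<not> adj j j" and kk: "\<not> adj k k"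
    and i: "i \<noteq> j" "i \<noteq> k" "adj i j"
  shows "\<not> adj i k"
proof
  assume ik: "adj i k"
  define a :: "real ^ 'n" where "a = (\<chi> l. if l = j \<or> l = k then 1 else 0)"
  have nth: "a $ l = (if l = j \<or> l = k then 1 else 0)" for l
    by (simp add: a_def)
  have "axis j 1 = (axis k 1 :: real ^ 'n) \<or> axis j 1 = (axis i 1 + axis j 1 :: real ^ 'n)"
  proof (rule peak_parallelogram[of "axis j 1 + axis k 1" a _ "axis i 1 + axis k 1"])
    show "a \<in> int_lattice"
      by (simp add: int_lattice_def nth)
    show "a \<bullet> p < a \<bullet> (axis j 1 + axis k 1)"
      if p: "p \<in> Q \<inter> int_lattice" "p \<noteq> axis j 1 + axis k 1" for p
      using p(1)
    proof (rule lattice_point_cases)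
      fix l m assume lm: "p = axis l 1 + axis m 1" "adj l m"
      then have "\<not> (l \<in> {j, k} \<and> m \<in> {j, k})"
        using jj kk p(2) by (auto simp: add.commute)
      then show ?thesis
        using jk(1) by (auto simp: lm(1) axis_simps nth)
    qed (use jk(1) in \<open>auto simp: axis_simps nth\<close>)
  qed (use ik i jk lattice_points in \<open>auto simp: axis_simps nth simp del: Int_iff\<close>)
  then show False
    using jk(1) by (auto simp: axis_eq_axis axis_eq_0_iff)
qed

text \<open>A looped vertex is adjacent to every other: to looped ones by
  \<open>adj_diagonal\<close>, to a loopless \<open>i\<close> because otherwise transitivity through
  \<open>i\<close> would remove the loop. Two adjacent loopless vertices would then have it as a
  common neighbour. Without loops, non-adjacency is an equivalence relation and triangles are
  excluded, so an edge leaves exactly two classes.\<close>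

lemma adj_cases:
  obtains (none) "\<And>i j. \<not> adj i j"
  | (bipartite) I where "I \<noteq> {}" "I \<noteq> UNIV" "\<And>i j. adj i j \<longleftrightarrow> (i \<in> I) \<noteq> (j \<in> I)"
  | (loops) N where "N \<noteq> UNIV" "\<And>i j. adj i j \<longleftrightarrow> i \<notin> N \<or> j \<notin> N"
proof (cases "\<exists>i. adj i i")
  case True
  then obtain l where l: "adj l l"
    by blast
  define N where "N = {i. \<not> adj i i}"
  have outside: "adj i j" if "i \<notin> N \<or> j \<notin> N" for i j
    using that adj_diagonal[of i j] not_adj_trans[of j i i] not_adj_trans[of i j j] adj_sym[of i j]
    unfolding N_def by blast
  have inside: "\<not> adj i j" if "i \<in> N" "j \<in> N" for i j
    using that l no_common_neighbour[of i j l] outside[of l i] outside[of l j]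
    unfolding N_def by blast
  show ?thesis
  proof (rule loops[of N])
    show "N \<noteq> UNIV"
      using l by (auto simp: N_def)
    show "adj i j \<longleftrightarrow> i \<notin> N \<or> j \<notin> N" for i j
      using inside[of i j] outside[of i j] by blast
  qed
next
  case no_loops: False
  show ?thesis
  proof (cases "\<exists>j k. adj j k")
    case True
    then obtain j k where jk: "adj j k"
      by blast
    then have "j \<noteq> k"
      using no_loops by blast
    define I where "I = {i. adj i k}"
    \<comment> \<open>A vertex is adjacent to exactly one end of the edge: to both would form a
      triangle, and to neither would separate \<open>j\<close> from \<open>k\<close> by transitivity
      through \<open>i\<close>.\<close>
    have jI: "i \<in> I \<longleftrightarrow> \<not> adj i j" for i
      using jk \<open>j \<noteq> k\<close> no_loops no_common_neighbour[of j k i] not_adj_trans[of i j k]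
        adj_sym[of j k]
      unfolding I_def by blast
    have same: "\<not> adj x y" if "x \<in> I \<longleftrightarrow> y \<in> I" for x y
      using that jI[of x] jI[of y] not_adj_trans[of j x y] not_adj_trans[of k x y] no_loops
        adj_sym[of j x] adj_sym[of j y] adj_sym[of k x] adj_sym[of k y]
      unfolding I_def by blast
    have cross: "adj x y" if "x \<in> I" "y \<notin> I" for x y
      using that jI[of x] jI[of y] not_adj_trans[of x j y] no_loops adj_sym[of y j] by blast
    show ?thesis
    proof (rule bipartite[of I])
      show "adj x y \<longleftrightarrow> (x \<in> I) \<noteq> (y \<in> I)" for x y
        using same[of x y] cross[of x y] cross[of y x] adj_sym[of x y] by blast
    qed (use jk no_loops in \<open>auto simp: I_def\<close>)
  qed (use none in blast)
qed

end

section \<open>The model polytopes\<close>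

lemma dilated_simplex_lattice_polytope:
  "lattice_polytope (dilated_simplex 1 :: (real ^ 'n) set)"
  "lattice_polytope (dilated_simplex 2 :: (real ^ 'n) set)"
proof -
  have Basis: "(Basis :: (real ^ 'n) set) = range (\<lambda>i. axis i 1)"
    by (auto simp: Basis_vec_def)
  have "(\<Sum>b\<in>Basis. x \<bullet> b) = (\<Sum>i\<in>UNIV. x $ i)" for x :: "real ^ 'n"
    unfolding Basis by (subst sum.reindex) (auto simp: inj_on_def axis_eq_axis inner_axis_1)
  then have 1: "(dilated_simplex 1 :: (real ^ 'n) set) = convex hull (insert 0 Basis)"
    unfolding std_simplex by (auto simp: dilated_simplex_def Basis inner_axis_1)
  have "(dilated_simplex 2 :: (real ^ 'n) set) = (*\<^sub>R) 2 ` dilated_simplex 1"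
  proof (intro equalityI subsetI)
    fix x :: "real ^ 'n" assume "x \<in> dilated_simplex 2"
    then have "(1/2) *\<^sub>R x \<in> dilated_simplex 1"
      by (auto simp: dilated_simplex_def simp flip: sum_divide_distrib)
    then show "x \<in> (*\<^sub>R) 2 ` dilated_simplex 1"
      by (intro image_eqI[of _ _ "(1/2) *\<^sub>R x"]) auto
  qed (auto simp: dilated_simplex_def simp flip: sum_distrib_left)
  then have 2: "(dilated_simplex 2 :: (real ^ 'n) set) = convex hull ((*\<^sub>R) 2 ` insert 0 Basis)"
    unfolding 1 convex_hull_scaling .
  show "lattice_polytope (dilated_simplex 1 :: (real ^ 'n) set)"
    unfolding lattice_polytope_def
    by (intro exI[of _ "insert 0 Basis"] conjI 1)
      (auto simp: Basis int_lattice_zero int_lattice_axis)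
  show "lattice_polytope (dilated_simplex 2 :: (real ^ 'n) set)"
    unfolding lattice_polytope_def
    by (intro exI[of _ "(*\<^sub>R) 2 ` insert 0 Basis"] conjI 2)
      (auto simp: Basis int_lattice_def axis_1_nth)
qed

lemma axis_mem_dilated_simplex: "c \<ge> 1 \<Longrightarrow> axis i 1 \<in> dilated_simplex c"
  by (simp add: dilated_simplex_def axis_1_nth)

lemma axis_add_mem_dilated_simplex: "axis i 1 + axis j 1 \<in> dilated_simplex c \<longleftrightarrow> c \<ge> 2"
  by (simp add: dilated_simplex_def axis_1_nth sum.distrib)

lemma sandwiched_dilated_simplex:
  assumes "c \<in> {1, 2}"
  shows "sandwiched_polytope (dilated_simplex c :: (real ^ 'n) set)"
proof
  show "lattice_polytope (dilated_simplex c :: (real ^ 'n) set)"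
    using assms dilated_simplex_lattice_polytope by auto
qed (use assms in \<open>auto simp: axis_mem_dilated_simplex\<close>, auto simp: dilated_simplex_def)

text \<open>The product is the Minkowski sum of two unit simplices in complementary coordinate
  subspaces, and convex hulls commute with Minkowski sums.\<close>

lemma simplex_product_lattice_polytope:
  "lattice_polytope (simplex_product I :: (real ^ 'n) set)"
proof -
  define A :: "'n set \<Rightarrow> (real ^ 'n) set" where "A J = insert 0 ((\<lambda>i. axis i 1) ` J)" for J
  have hull: "convex hull (A J) =
    {x. (\<forall>i. 0 \<le> x $ i) \<and> (\<Sum>i\<in>J. x $ i) \<le> 1 \<and> (\<forall>i. i \<notin> J \<longrightarrow> x $ i = 0)}" for J
  proof -
    have "(\<Sum>b\<in>(\<lambda>i. axis i 1) ` J. x \<bullet> b) = (\<Sum>i\<in>J. x $ i)" for x :: "real ^ 'n"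
      by (subst sum.reindex) (auto simp: inj_on_def axis_eq_axis inner_axis_1)
    moreover have Basis: "(Basis :: (real ^ 'n) set) = range (\<lambda>i. axis i 1)"
      by (auto simp: Basis_vec_def)
    ultimately show ?thesis
      unfolding A_def by (subst substd_simplex) (auto simp: Basis inner_axis_1 axis_eq_axis image_iff)
  qed
  have "simplex_product I = {x + y |x y. x \<in> convex hull (A I) \<and> y \<in> convex hull (A (- I))}"
  proof (intro equalityI subsetI)
    fix p assume p: "p \<in> simplex_product I"
    define x where "x = (\<chi> i. if i \<in> I then p $ i else 0)"
    define y where "y = (\<chi> i. if i \<in> I then 0 else p $ i)"
    have "p = x + y"
      by (simp add: x_def y_def vec_eq_iff)
    moreover have "x \<in> convex hull (A I)" "y \<in> convex hull (A (- I))"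
      using p by (auto simp: hull x_def y_def simplex_product_def)
    ultimately show "p \<in> {x + y |x y. x \<in> convex hull (A I) \<and> y \<in> convex hull (A (- I))}"
      by blast
  qed (auto simp: hull simplex_product_def sum.distrib)
  also have "\<dots> = convex hull (A I) + convex hull (A (- I))"
    by (auto simp: set_plus_def)
  also have "\<dots> = convex hull (A I + A (- I))"
    by (simp add: convex_hull_set_plus)
  finally have "simplex_product I = convex hull (A I + A (- I))" .
  moreover have "finite (A I + A (- I))"
    by (simp add: A_def finite_set_plus)
  moreover have "A I + A (- I) \<subseteq> int_lattice"
    by (auto simp: A_def set_plus_def int_lattice_zero int_lattice_axis intro: int_lattice_add)
  ultimately show ?thesis
    unfolding lattice_polytope_def by blast
qed

lemma sum_axis: "(\<Sum>i\<in>A. axis k (1::real) $ i) = (if k \<in> A then 1 else 0)" if "finite A"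
  using that by (simp add: axis_1_nth)

lemma sandwiched_simplex_product: "sandwiched_polytope (simplex_product I :: (real ^ 'n) set)"
proof
  show "simplex_product I \<subseteq> (dilated_simplex 2 :: (real ^ 'n) set)"
  proof
    fix x :: "real ^ 'n" assume x: "x \<in> simplex_product I"
    have "(\<Sum>i\<in>UNIV. x $ i) = (\<Sum>i\<in>I. x $ i) + (\<Sum>i\<in>- I. x $ i)"
      by (metis Compl_disjoint Compl_partition finite sum.union_disjoint)
    with x show "x \<in> dilated_simplex 2"
      by (simp add: simplex_product_def dilated_simplex_def)
  qed
qed (auto simp: simplex_product_lattice_polytope, auto simp: simplex_product_def sum_axis axis_1_nth)

lemma axis_add_mem_simplex_product:
  "axis i 1 + axis j 1 \<in> simplex_product I \<longleftrightarrow> (i \<in> I) \<noteq> (j \<in> I)"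
  by (auto simp: simplex_product_def sum.distrib sum_axis, auto simp: axis_1_nth)

text \<open>The face of \<open>2\<Delta>\<^sub>n\<close> spanned by the vertices
  \<open>2e\<^sub>i\<close> with \<open>i\<close> in \<open>N\<close>; it is empty for empty
  \<open>N\<close>. Since the normal form contains 0, only faces that avoid the origin can be cut
  off.\<close>

definition double_face :: "'n set \<Rightarrow> (real ^ 'n) set" where
  "double_face N = {x \<in> dilated_simplex 2. (\<Sum>i\<in>N. x $ i) = 2}"

lemma sum_eq_inner: "(\<Sum>i\<in>N. x $ i) = (\<chi> i. of_bool (i \<in> N)) \<bullet> (x :: real ^ 'n)"
  by (simp add: inner_vec_def of_bool_def if_distrib[of "\<lambda>c. c * _"] sum.If_cases cong: if_cong)

lemma dilated_simplex_sum_le: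
  assumes "x \<in> dilated_simplex c"
  shows "(\<Sum>i\<in>N. x $ i) \<le> c"
  using assms sum_mono2[of UNIV N "\<lambda>i. x $ i"] by (auto simp: dilated_simplex_def)

lemma double_face_face_of: "double_face N face_of dilated_simplex 2"
proof -
  have "dilated_simplex 2 \<inter> {x. (\<chi> i. of_bool (i \<in> N)) \<bullet> x = 2} face_of dilated_simplex 2"
    by (intro face_of_Int_supporting_hyperplane_le convex_dilated_simplex)
      (simp add: dilated_simplex_sum_le flip: sum_eq_inner)
  moreover have "double_face N = dilated_simplex 2 \<inter> {x. (\<chi> i. of_bool (i \<in> N)) \<bullet> x = 2}"
    by (auto simp: double_face_def sum_eq_inner)
  ultimately show ?thesis
    by simp
qed

text \<open>On this face the coordinates outside \<open>N\<close> vanish, because those in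
  \<open>N\<close> already use up the sum 2. So it is the hull of the linearly independent points
  \<open>2e\<^sub>i\<close> with \<open>i\<close> in \<open>N\<close>.\<close>

lemma aff_dim_double_face: "aff_dim (double_face N :: (real ^ 'n) set) = int (card N) - 1"
proof -
  define A :: "(real ^ 'n) set" where "A = (\<lambda>i. axis i 2) ` N"
  have "double_face N = convex hull A"
  proof (intro equalityI subsetI)
    fix x :: "real ^ 'n" assume x: "x \<in> double_face N"
    then have nonneg: "0 \<le> x $ i" for i
      by (simp add: double_face_def dilated_simplex_def)
    have "(\<Sum>i\<in>UNIV. x $ i) = (\<Sum>i\<in>N. x $ i) + (\<Sum>i\<in>- N. x $ i)"
      by (metis Compl_disjoint Compl_partition finite sum.union_disjoint)
    then have "(\<Sum>i\<in>- N. x $ i) \<le> 0"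
      using x by (simp add: double_face_def dilated_simplex_def)
    then have zero: "x $ i = 0" if "i \<notin> N" for i
      using that nonneg sum_nonneg_eq_0_iff[of "- N" "\<lambda>i. x $ i"] sum_nonneg[of "- N" "\<lambda>i. x $ i"]
      by (metis ComplI antisym finite)
    have "(\<Sum>i\<in>N. (x $ i / 2) *\<^sub>R axis i 2) \<in> convex hull A"
      using x nonneg
      by (intro convex_sum) (auto simp: A_def double_face_def hull_inc simp flip: sum_divide_distrib)
    also have "(\<Sum>i\<in>N. (x $ i / 2) *\<^sub>R axis i 2) = x"
      using zero by (auto simp: vec_eq_iff axis_def if_distrib[of "\<lambda>c. _ * c"] cong: if_cong)
    finally show "x \<in> convex hull A" .
  next
    have "A \<subseteq> double_face N"
      by (auto simp: A_def double_face_def dilated_simplex_def axis_def)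
    moreover have "convex (double_face N)"
      using double_face_face_of face_of_imp_convex by blast
    ultimately show "x \<in> double_face N" if "x \<in> convex hull A" for x
      using that hull_minimal by blast
  qed
  moreover have "independent A"
  proof -
    have "independent ((\<lambda>i. axis i 1) ` N :: (real ^ 'n) set)"
      by (rule independent_mono[OF independent_Basis]) (auto simp: Basis_vec_def)
    then have "independent ((*\<^sub>R) 2 ` ((\<lambda>i. axis i 1) ` N :: (real ^ 'n) set))"
      by (intro linear_independent_injective_image) (auto intro: inj_onI linear_scaleR)
    moreover have "2 *\<^sub>R axis i 1 = (axis i 2 :: real ^ 'n)" for i
      by (simp add: vec_eq_iff axis_def)
    then have "(*\<^sub>R) 2 ` (\<lambda>i. axis i 1) ` N = A"
      by (simp add: A_def image_image)
    ultimately show ?thesis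
      by simp
  qed
  moreover have "card A = card N"
    unfolding A_def by (intro card_image) (auto simp: inj_on_def axis_eq_axis)
  ultimately show ?thesis
    using affine_dependent_imp_dependent[of A] aff_dim_affine_independent[of A]
    by (metis aff_dim_convex_hull add_diff_cancel_right')
qed

lemma finite_lattice_dilated_simplex_2:
  "finite (int_lattice \<inter> dilated_simplex 2 :: (real ^ 'n) set)"
proof (rule finite_subset)
  show "(int_lattice \<inter> dilated_simplex 2 :: (real ^ 'n) set) \<subseteq>
    {0} \<union> range (\<lambda>i. axis i 1) \<union> range (\<lambda>(i, j). axis i 1 + axis j 1)"
    by (auto elim!: dilated_simplex_2_lattice_cases)
qed auto

text \<open>0 and the unit vectors have coordinate sum at most 1 over \<open>N\<close>, so they
  survive the removal of the face.\<close>

lemma sandwiched_truncated_double_simplex: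
  "sandwiched_polytope (truncated_double_simplex (double_face N) :: (real ^ 'n) set)"
proof
  let ?S = "int_lattice \<inter> (dilated_simplex 2 - double_face N) :: (real ^ 'n) set"
  have "finite ?S"
    by (rule finite_subset[OF _ finite_lattice_dilated_simplex_2]) auto
  then show "lattice_polytope (truncated_double_simplex (double_face N) :: (real ^ 'n) set)"
    unfolding truncated_double_simplex_def lattice_polytope_def by blast
  show "truncated_double_simplex (double_face N) \<subseteq> (dilated_simplex 2 :: (real ^ 'n) set)"
    unfolding truncated_double_simplex_def by (intro hull_minimal convex_dilated_simplex) auto
  have "0 \<in> ?S" "axis i 1 \<in> ?S" for i
    by (auto simp: int_lattice_zero int_lattice_axis double_face_def sum_axis axis_mem_dilated_simplex)
      (auto simp: dilated_simplex_def)
  then show "0 \<in> truncated_double_simplex (double_face N)"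
    "axis i 1 \<in> truncated_double_simplex (double_face N)" for i :: 'n
    unfolding truncated_double_simplex_def by (blast intro: hull_inc)+
qed

text \<open>Every lattice point off the face has sum over \<open>N\<close> strictly below 2, and the
  hull stays in this open half-space. With \<open>i\<close> and \<open>j\<close> both in
  \<open>N\<close> the sum is 2; otherwise the point itself is off the face.\<close>

lemma axis_add_mem_truncated_double_simplex:
  fixes i j :: "'n::finite"
  shows "axis i 1 + axis j 1 \<in> truncated_double_simplex (double_face N) \<longleftrightarrow> i \<notin> N \<or> j \<notin> N"
proof
  let ?a = "(\<chi> i. of_bool (i \<in> N)) :: real ^ 'n"
  assume "axis i 1 + axis j 1 \<in> truncated_double_simplex (double_face N)"
  moreover have "truncated_double_simplex (double_face N) \<subseteq> {x. ?a \<bullet> x < 2}"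
    unfolding truncated_double_simplex_def
    using dilated_simplex_sum_le[of _ 2 N]
    by (intro hull_minimal convex_halfspace_lt)
      (auto simp: double_face_def less_le simp flip: sum_eq_inner)
  ultimately show "i \<notin> N \<or> j \<notin> N"
    by (auto simp: axis_simps)
next
  assume "i \<notin> N \<or> j \<notin> N"
  then have "axis i 1 + axis j 1 \<in> int_lattice \<inter> (dilated_simplex 2 - double_face N)"
    by (auto simp: axis_add_mem_dilated_simplex double_face_def sum.distrib sum_axis
        intro: int_lattice_add int_lattice_axis)
  then show "axis i 1 + axis j 1 \<in> truncated_double_simplex (double_face N)"
    unfolding truncated_double_simplex_def by (rule hull_inc)
qed

theorem theorem4p6:
  fixes P :: "(real ^ 'n) set"
  assumes "smooth_polytope P"
    and "aff_dim P = int CARD('n)"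
    and "P \<subseteq> dilated_simplex 2"
  shows "AGL_equivalent P (dilated_simplex 1) \<or>
         AGL_equivalent P (dilated_simplex 2) \<or>
         (\<exists>k F. k + 2 \<le> CARD('n) \<and> F face_of (dilated_simplex 2 :: (real ^ 'n) set) \<and>
                aff_dim F = int k \<and> AGL_equivalent P (truncated_double_simplex F)) \<or>
         (\<exists>l I. 1 \<le> l \<and> l + 1 \<le> CARD('n) \<and> card I = l \<and>
                AGL_equivalent P (simplex_product I))"
proof -
  obtain Q where PQ: "AGL_equivalent P Q" and Q: "lattice_polytope Q" "Q \<subseteq> dilated_simplex 2"
    "0 \<in> Q" "\<And>i. axis i 1 \<in> Q" "\<And>w. w extreme_point_of Q \<Longrightarrow> \<exists>B. unimodular_at Q w B"
    using smooth_polytope_normal_form[OF assms] by metis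
  interpret unimodular_sandwiched_polytope Q
    using Q by unfold_locales auto
  have eqI: "Q = T" if T: "sandwiched_polytope T"
    and "\<And>i j. adj i j \<longleftrightarrow> axis i 1 + axis j 1 \<in> T" for T
    using that by (intro sandwiched_polytope_eqI sandwiched_polytope_axioms)
      (auto simp: sandwiched_polytope.adj_def[OF T])
  show ?thesis
  proof (cases rule: adj_cases)
    case none
    then have "Q = dilated_simplex 1"
      by (intro eqI sandwiched_dilated_simplex) (auto simp: axis_add_mem_dilated_simplex)
    then show ?thesis
      using PQ by simp
  next
    case (bipartite I)
    then have "Q = simplex_product I"
      by (intro eqI sandwiched_simplex_product) (auto simp: axis_add_mem_simplex_product)
    moreover have "1 \<le> card I"
      using bipartite(1) by (simp add: Suc_le_eq card_gt_0_iff)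
    moreover have "card I < CARD('n)"
      using bipartite(2) by (intro psubset_card_mono) auto
    ultimately show ?thesis
      using PQ by (auto simp: Suc_le_eq)
  next
    case (loops N)
    show ?thesis
    \<comment> \<open>For empty \<open>N\<close> the graph is complete with all loops, and nothing
      is cut off.\<close>
    proof (cases "N = {}")
      case True
      then have "Q = dilated_simplex 2"
        using loops by (intro eqI sandwiched_dilated_simplex) (auto simp: axis_add_mem_dilated_simplex)
      then show ?thesis
        using PQ by simp
    next
      case False
      have "Q = truncated_double_simplex (double_face N)"
        using loops(2) by (intro eqI sandwiched_truncated_double_simplex)
          (auto simp: axis_add_mem_truncated_double_simplex)
      moreover have "card N > 0"
        using False by (simp add: card_gt_0_iff)
      moreover have "card N < CARD('n)"
        using loops(1) by (intro psubset_card_mono) auto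
      \<comment> \<open>Here \<open>k\<close> is \<open>card N - 1\<close>: the subtraction is exact
        because \<open>N\<close> is nonempty, and \<open>N\<close> being a proper subset gives
        \<open>k + 2 \<le> CARD('n)\<close>.\<close>
      ultimately have "card N - 1 + 2 \<le> CARD('n)" "aff_dim (double_face N) = int (card N - 1)"
        "AGL_equivalent P (truncated_double_simplex (double_face N))"
        using PQ by (auto simp: aff_dim_double_face)
      then show ?thesis
        using double_face_face_of by blast
    qed
  qed
qed

end
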